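(* Let $G$ be a finite simple graph that is bull-free and odd torch-free (i.e. $G$ contains no induced subgraph isomorphic to the bull nor to any odd torch). Then $G$ is perfectly weight divisible, and hence $G$ is perfectly divisible.
   Context: Graphs are finite and simple; "$G$ contains $H$" means $H$ is isomorphic to an induced subgraph of $G$, and $G$ is $H$-free otherwise. A bull is the graph consisting of a triangle with two disjoint pendant edges (vertices $a,b,c$ forming a triangle, plus $d$ adjacent only to $a$ and $e$ adjacent only to $b$). A hole is an induced cycle of length at least $4$; it is odd if its length is odd. An odd torch is a graph obtained from an odd hole $C$ by adding two new vertices $x,y$ with $xy$ an edge, $x$ adjacent to no vertex of $C$, and the neighbours of $y$ on $C$ forming a nonempty stable set of $C$. A graph is perfect if $\chi(H)=\omega(H)$ for every induced subgraph $H$. A graph $G$ is perfectly divisible if for every induced subgraph $H$ of $G$, $V(H)$ can be partitioned into $A,B$ with $H[A]$ perfect and $\omega(H[B])<\omega(H)$. For a weight function $w$ on $V(G)$, $\omega_w(G)$ is the maximum total weight of a clique of $G$. $G$ is perfectly weight divisible if for every positive integer weight function $w$ on $V(G)$ and every induced subgraph $H$ of $G$, there is a partition of $V(H)$ into $P,W$ with $H[P]$ perfect and $\omega_w(H[W])<\omega_w(H)$. *)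

theory Defs
  imports Main
begin

record 'a graph =
  verts :: "'a set"
  adj :: "'a \<Rightarrow> 'a \<Rightarrow> bool"

definition simple_graph :: "'a graph \<Rightarrow> bool" where
  "simple_graph G \<longleftrightarrow>
     finite (verts G) \<and>
     (\<forall>x y. adj G x y \<longrightarrow> x \<in> verts G \<and> y \<in> verts G) \<and>
     (\<forall>x y. adj G x y \<longrightarrow> adj G y x) \<and>
     (\<forall>x. \<not> adj G x x)"

text \<open>Only used for vertex sets \<open>S \<subseteq> verts G\<close>.\<close>

definition induced :: "'a graph \<Rightarrow> 'a set \<Rightarrow> 'a graph" where
  "induced G S = \<lparr>verts = S, adj = (\<lambda>x y. x \<in> S \<and> y \<in> S \<and> adj G x y)\<rparr>"

definition graph_iso :: "'a graph \<Rightarrow> 'b graph \<Rightarrow> bool" where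
  "graph_iso G H \<longleftrightarrow>
     (\<exists>f. bij_betw f (verts G) (verts H) \<and>
          (\<forall>x\<in>verts G. \<forall>y\<in>verts G. adj G x y \<longleftrightarrow> adj H (f x) (f y)))"

definition contains_graph :: "'a graph \<Rightarrow> 'b graph \<Rightarrow> bool" where
  "contains_graph G H \<longleftrightarrow> (\<exists>S. S \<subseteq> verts G \<and> graph_iso H (induced G S))"

definition free_of :: "'b graph \<Rightarrow> 'a graph \<Rightarrow> bool" where
  "free_of H G \<longleftrightarrow> \<not> contains_graph G H"

definition is_clique :: "'a graph \<Rightarrow> 'a set \<Rightarrow> bool" where
  "is_clique G K \<longleftrightarrow> K \<subseteq> verts G \<and> (\<forall>x\<in>K. \<forall>y\<in>K. x \<noteq> y \<longrightarrow> adj G x y)"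

definition is_stable :: "'a graph \<Rightarrow> 'a set \<Rightarrow> bool" where
  "is_stable G S \<longleftrightarrow> S \<subseteq> verts G \<and> (\<forall>x\<in>S. \<forall>y\<in>S. \<not> adj G x y)"

text \<open>The empty set is a clique, so these maxima are over nonempty sets, and both numbers
  are 0 for the graph without vertices.\<close>

definition clique_number :: "'a graph \<Rightarrow> nat" where
  "clique_number G = Max {card K | K. is_clique G K}"

definition weighted_clique_number :: "('a \<Rightarrow> nat) \<Rightarrow> 'a graph \<Rightarrow> nat" where
  "weighted_clique_number w G = Max {sum w K | K. is_clique G K}"

definition colourable :: "'a graph \<Rightarrow> nat \<Rightarrow> bool" where
  "colourable G k \<longleftrightarrow>
     (\<exists>c :: 'a \<Rightarrow> nat. (\<forall>x\<in>verts G. c x < k) \<and> (\<forall>x y. adj G x y \<longrightarrow> c x \<noteq> c y))"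

definition chromatic_number :: "'a graph \<Rightarrow> nat" where
  "chromatic_number G = (LEAST k. colourable G k)"

definition perfect :: "'a graph \<Rightarrow> bool" where
  "perfect G \<longleftrightarrow>
     (\<forall>S. S \<subseteq> verts G \<longrightarrow> chromatic_number (induced G S) = clique_number (induced G S))"

text \<open>The vertices \<open>a, b, c, d, e\<close> of the bull are \<open>0, 1, 2, 3, 4\<close>.\<close>

definition bull :: "nat graph" where
  "bull = (let E = {(0,1), (0,2), (1,2), (0,3), (1,4)}
           in \<lparr>verts = {0, 1, 2, 3, 4}, adj = (\<lambda>x y. (x, y) \<in> E \<or> (y, x) \<in> E)\<rparr>)"

text \<open>A cycle of length \<open>n\<close> for \<open>n \<ge> 3\<close>.\<close>

definition cycle_graph :: "nat \<Rightarrow> nat graph" where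
  "cycle_graph n =
     \<lparr>verts = {..<n},
      adj = (\<lambda>i j. i < n \<and> j < n \<and> (j = Suc i mod n \<or> i = Suc j mod n))\<rparr>"

definition hole :: "'a graph \<Rightarrow> 'a set \<Rightarrow> bool" where
  "hole G C \<longleftrightarrow>
     C \<subseteq> verts G \<and> card C \<ge> 4 \<and> graph_iso (cycle_graph (card C)) (induced G C)"

definition odd_hole :: "'a graph \<Rightarrow> 'a set \<Rightarrow> bool" where
  "odd_hole G C \<longleftrightarrow> hole G C \<and> odd (card C)"

definition odd_torch :: "'a graph \<Rightarrow> bool" where
  "odd_torch T \<longleftrightarrow> simple_graph T \<and>
     (\<exists>C x y. verts T = C \<union> {x, y} \<and> x \<notin> C \<and> y \<notin> C \<and> x \<noteq> y \<and>
        odd_hole T C \<and> adj T x y \<and> (\<forall>v\<in>C. \<not> adj T x v) \<and>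
        {v\<in>C. adj T y v} \<noteq> {} \<and> is_stable T {v\<in>C. adj T y v})"

definition bull_free :: "'a graph \<Rightarrow> bool" where
  "bull_free G \<longleftrightarrow> free_of bull G"

text \<open>Letting \<open>T\<close> range over graphs of the same vertex type as \<open>G\<close> loses nothing: an induced
  subgraph of a simple graph \<open>G\<close> that is isomorphic to an odd torch is itself an odd torch.\<close>

definition odd_torch_free :: "'a graph \<Rightarrow> bool" where
  "odd_torch_free G \<longleftrightarrow> (\<forall>T :: 'a graph. odd_torch T \<longrightarrow> free_of T G)"

text \<open>In both definitions below \<open>H\<close> ranges over the nonempty induced subgraphs only: the graph
  without vertices has clique number 0, so that no partition of it could decrease this number.
  The parts of a partition may be empty.\<close>

definition perfectly_divisible :: "'a graph \<Rightarrow> bool" where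
  "perfectly_divisible G \<longleftrightarrow>
     (\<forall>S. S \<subseteq> verts G \<and> S \<noteq> {} \<longrightarrow>
       (let H = induced G S in
         \<exists>A B. A \<union> B = verts H \<and> A \<inter> B = {} \<and> perfect (induced H A) \<and>
               clique_number (induced H B) < clique_number H))"

definition perfectly_weight_divisible :: "'a graph \<Rightarrow> bool" where
  "perfectly_weight_divisible G \<longleftrightarrow>
     (\<forall>w :: 'a \<Rightarrow> nat. (\<forall>v\<in>verts G. w v > 0) \<longrightarrow>
       (\<forall>S. S \<subseteq> verts G \<and> S \<noteq> {} \<longrightarrow>
         (let H = induced G S in
           \<exists>P W. P \<union> W = verts H \<and> P \<inter> W = {} \<and> perfect (induced H P) \<and>
                 weighted_clique_number w (induced H W) < weighted_clique_number w H)))"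

end

theory Submission
  imports Defs Complex_Main
begin

text \<open>If \<open>X\<close> is a homogeneous set, then replacing \<open>X\<close> by one vertex whose weight is the maximum
  weight of a clique in \<open>X\<close> reduces the claim to smaller graphs. So suppose that \<open>G\<close> is prime. It
  suffices that the nonneighbours of some vertex \<open>v\<close> induce a perfect graph \<open>M\<close>: take \<open>P\<close> to be
  \<open>M\<close> together with \<open>v\<close>, and \<open>W\<close> the neighbourhood of \<open>v\<close>. In a prime bull-free graph, a hole or
  antihole that has an anticomplete vertex has an attachment \<open>y\<close> that is adjacent to a stable set of
  it, with a neighbour \<open>x\<close> that is anticomplete to it. For odd holes this is an odd torch, for
  antiholes of length at least 6 there is a bull; so \<open>M\<close> contains neither.

  The strong perfect graph theorem is not needed. A minimal imperfect induced subgraph \<open>H\<close> of \<open>M\<close>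
  has no homogeneous set, and neither \<open>H\<close> nor its complement has a star cutset. Since \<open>H\<close> contains
  a triangle (else it is bipartite or has an odd hole), all its neighbourhoods turn out to be
  connected, so that every long hole has a vertex complete to it; in the complement of \<open>H\<close> this is
  an antihole with an anticomplete vertex. Hence \<open>H\<close> has no holes of length at least 5 and no
  antiholes of length at least 6, and Hayward's argument finds a nonneighbour of a vertex that
  dominates it, which is impossible in a minimal imperfect graph.\<close>

text \<open>The obstacle is that \<open>v\<close> says nothing about even holes of length at least 6
  in \<open>M\<close>, since a torch needs an odd cycle. They are excluded inside \<open>H\<close>,
  by its criticality: in connected neighbourhoods two consecutive vertices of the hole have a common
  neighbour \<open>u\<close>, bulls carry the adjacency of \<open>u\<close> around the hole, and in
  the complement \<open>u\<close> is anticomplete to an antihole. So bull-freeness, primality and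
  minimal imperfection all have to pass to the complement. For the last one this is the perfect
  graph theorem, proved by Gasparian's rank argument; the resulting count also makes
  \<open>H\<close> prime, and primality in turn shows that substituting one perfect graph into
  another preserves perfection, as the weight induction requires. The bound 6 for antiholes comes
  from the bull on \<open>h 1\<close>, \<open>h 3\<close>, \<open>h (n - 1)\<close>, whose last two
  vertices must not be consecutive. The antihole of length 5 is itself an odd hole.\<close>

definition co :: "('a \<Rightarrow> 'a \<Rightarrow> bool) \<Rightarrow> 'a \<Rightarrow> 'a \<Rightarrow> bool" where
  "co r x y \<longleftrightarrow> x \<noteq> y \<and> \<not> r x y"

definition clique :: "('a \<Rightarrow> 'a \<Rightarrow> bool) \<Rightarrow> 'a set \<Rightarrow> bool" where
  "clique r K \<longleftrightarrow> (\<forall>x\<in>K. \<forall>y\<in>K. x \<noteq> y \<longrightarrow> r x y)"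

definition colourable_on :: "('a \<Rightarrow> 'a \<Rightarrow> bool) \<Rightarrow> 'a set \<Rightarrow> nat \<Rightarrow> bool" where
  "colourable_on r S k \<longleftrightarrow>
     (\<exists>c :: 'a \<Rightarrow> nat. (\<forall>x\<in>S. c x < k) \<and> (\<forall>x\<in>S. \<forall>y\<in>S. r x y \<longrightarrow> c x \<noteq> c y))"

text \<open>Ranging over all upper bounds \<open>k\<close> of the clique sizes expresses that the
  chromatic number is at most the clique number, without \<open>Max\<close> or
  \<open>LEAST\<close>.\<close>

definition perfect_on :: "('a \<Rightarrow> 'a \<Rightarrow> bool) \<Rightarrow> 'a set \<Rightarrow> bool" where
  "perfect_on r V \<longleftrightarrow>
     (\<forall>S k. S \<subseteq> V \<longrightarrow> (\<forall>K\<subseteq>S. clique r K \<longrightarrow> card K \<le> k) \<longrightarrow> colourable_on r S k)"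

definition min_imperfect :: "('a \<Rightarrow> 'a \<Rightarrow> bool) \<Rightarrow> 'a set \<Rightarrow> bool" where
  "min_imperfect r V \<longleftrightarrow> finite V \<and> \<not> perfect_on r V \<and> (\<forall>S. S \<subset> V \<longrightarrow> perfect_on r S)"

definition critical :: "('a \<Rightarrow> 'a \<Rightarrow> bool) \<Rightarrow> 'a set \<Rightarrow> nat \<Rightarrow> bool" where
  "critical r V w \<longleftrightarrow>
     (\<forall>K\<subseteq>V. clique r K \<longrightarrow> card K \<le> w) \<and> (\<exists>K\<subseteq>V. clique r K \<and> card K = w) \<and>
     \<not> colourable_on r V w \<and> (\<forall>S. S \<subset> V \<longrightarrow> colourable_on r S w)"

definition homogeneous :: "('a \<Rightarrow> 'a \<Rightarrow> bool) \<Rightarrow> 'a set \<Rightarrow> 'a set \<Rightarrow> bool" where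
  "homogeneous r V X \<longleftrightarrow> X \<subseteq> V \<and> (\<forall>u\<in>V - X. \<forall>a\<in>X. \<forall>b\<in>X. r u a \<longrightarrow> r u b)"

definition prime_on :: "('a \<Rightarrow> 'a \<Rightarrow> bool) \<Rightarrow> 'a set \<Rightarrow> bool" where
  "prime_on r V \<longleftrightarrow> finite V \<and> (\<forall>X. homogeneous r V X \<and> 2 \<le> card X \<longrightarrow> X = V)"

text \<open>Connectedness by cuts. The relation is a parameter, so \<open>conn (co r)\<close>
  expresses anticonnectedness.\<close>

definition conn :: "('a \<Rightarrow> 'a \<Rightarrow> bool) \<Rightarrow> 'a set \<Rightarrow> bool" where
  "conn r S \<longleftrightarrow> (\<forall>A\<subseteq>S. A \<noteq> {} \<and> A \<noteq> S \<longrightarrow> (\<exists>a\<in>A. \<exists>b\<in>S - A. r a b))"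

section \<open>Minimal imperfect graphs\<close>

text \<open>Gaussian elimination with unknowns \<open>I\<close> and equations \<open>V\<close>: a
  vanishing equation is dropped, any other one is solved for an unknown \<open>i0\<close>. It
  supplies the linear dependence for Gasparian's argument.\<close>

lemma underdetermined_linear_system:
  fixes a :: "'i \<Rightarrow> 'a \<Rightarrow> real"
  assumes "finite V" "finite I" "card V < card I"
  shows "\<exists>l. (\<exists>i\<in>I. l i \<noteq> 0) \<and> (\<forall>x\<in>V. (\<Sum>i\<in>I. l i * a i x) = 0)"
  using assms
proof (induction V arbitrary: I a rule: finite_induct)
  case empty
  then have "I \<noteq> {}" by auto
  then show ?case by (intro exI[of _ "\<lambda>_. 1"]) auto
next
  case (insert x V)
  show ?case
  proof (cases "\<forall>i\<in>I. a i x = 0")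
    case True
    obtain l where "\<exists>i\<in>I. l i \<noteq> 0" "\<forall>x\<in>V. (\<Sum>i\<in>I. l i * a i x) = 0"
      using insert.IH[of I a] insert.prems insert.hyps by auto
    then show ?thesis using True by (intro exI[of _ l]) auto
  next
    case False
    then obtain i0 where i0: "i0 \<in> I" "a i0 x \<noteq> 0" by auto
    define J where "J = I - {i0}"
    have J: "finite J" "I = insert i0 J" "i0 \<notin> J" using i0 insert.prems by (auto simp: J_def)
    \<comment> \<open>The coefficients after subtracting the multiple of column \<open>i0\<close>
      that clears equation \<open>x\<close>.\<close>
    define b where "b = (\<lambda>i y. a i y - a i x / a i0 x * a i0 y)"
    have "card V < card J" using insert.prems insert.hyps J by auto
    then obtain l where l: "\<exists>i\<in>J. l i \<noteq> 0" "\<forall>y\<in>V. (\<Sum>i\<in>J. l i * b i y) = 0"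
      using insert.IH[of J b] J by blast
    \<comment> \<open>The value of the eliminated unknown \<open>i0\<close> that equation
      \<open>x\<close> forces.\<close>
    define t where "t = - (\<Sum>i\<in>J. l i * a i x) / a i0 x"
    define l' where "l' = l(i0 := t)"
    have sum: "(\<Sum>i\<in>I. l' i * a i y) = t * a i0 y + (\<Sum>i\<in>J. l i * a i y)" for y
    proof -
      have "(\<Sum>i\<in>J. l' i * a i y) = (\<Sum>i\<in>J. l i * a i y)"
        by (rule sum.cong) (use J in \<open>auto simp: l'_def\<close>)
      then show ?thesis using J by (simp add: l'_def)
    qed
    have "(\<Sum>i\<in>I. l' i * a i y) = 0" if "y \<in> V" for y
    proof -
      have "0 = (\<Sum>i\<in>J. l i * b i y)" using l that by auto
      also have "\<dots> = (\<Sum>i\<in>J. l i * a i y) - (\<Sum>i\<in>J. (l i * a i x) * (a i0 y / a i0 x))"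
        by (simp add: b_def right_diff_distrib sum_subtractf mult.assoc)
      also have "(\<Sum>i\<in>J. (l i * a i x) * (a i0 y / a i0 x)) = (\<Sum>i\<in>J. l i * a i x) * (a i0 y / a i0 x)"
        by (simp only: sum_distrib_right)
      finally show ?thesis unfolding sum by (simp add: t_def)
    qed
    moreover have "(\<Sum>i\<in>I. l' i * a i x) = 0" unfolding sum using i0 by (simp add: t_def)
    moreover have "\<exists>i\<in>I. l' i \<noteq> 0"
    proof -
      obtain i where "i \<in> J" "l i \<noteq> 0" using l by blast
      then show ?thesis using J by (intro bexI[of _ i]) (auto simp: l'_def)
    qed
    ultimately show ?thesis by blast
  qed
qed

section \<open>Cliques, stable sets and colourings\<close>

lemma clique_subset: "clique r K \<Longrightarrow> L \<subseteq> K \<Longrightarrow> clique r L"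
  by (auto simp: clique_def)

lemma clique_stable_unique:
  "clique r K \<Longrightarrow> clique (co r) A \<Longrightarrow> x \<in> K \<inter> A \<Longrightarrow> y \<in> K \<inter> A \<Longrightarrow> x = y"
  unfolding clique_def co_def by blast

lemma perfect_on_subset: "perfect_on r V \<Longrightarrow> S \<subseteq> V \<Longrightarrow> perfect_on r S"
  unfolding perfect_on_def by (meson subset_trans)

lemma colourable_on_mono: "colourable_on r S k \<Longrightarrow> k \<le> m \<Longrightarrow> colourable_on r S m"
  unfolding colourable_on_def by (meson order_less_le_trans)

lemma colourable_on_add_stable:
  assumes "colourable_on r (V - A) k" and "clique (co r) A"
    and irr: "\<And>x. \<not> r x x"
  shows "colourable_on r V (Suc k)"
proof -
  obtain c where c: "\<forall>x\<in>V - A. c x < k" "\<forall>x\<in>V - A. \<forall>y\<in>V - A. r x y \<longrightarrow> c x \<noteq> (c y :: nat)"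
    using assms by (auto simp: colourable_on_def)
  have st: "\<not> r x y" if "x \<in> A" "y \<in> A" for x y
    using that assms by (cases "x = y") (auto simp: clique_def co_def)
  let ?c = "\<lambda>x. if x \<in> A then k else c x"
  have "\<forall>x\<in>V. ?c x < Suc k" using c by (auto simp: less_Suc_eq)
  moreover have "\<forall>x\<in>V. \<forall>y\<in>V. r x y \<longrightarrow> ?c x \<noteq> ?c y"
  proof (intro ballI impI)
    fix x y assume xy: "x \<in> V" "y \<in> V" "r x y"
    consider "x \<in> A" "y \<notin> A" | "x \<notin> A" "y \<in> A" | "x \<notin> A" "y \<notin> A" using st xy by blast
    then show "?c x \<noteq> ?c y"
    proof cases
      case 1
      then have "c y < k" using c xy by blast
      then show ?thesis using 1 by simp
    next
      case 2
      then have "c x < k" using c xy by blast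
      then show ?thesis using 2 by simp
    next
      case 3
      then show ?thesis using c xy by simp
    qed
  qed
  ultimately show ?thesis unfolding colourable_on_def by (intro exI[of _ ?c] conjI)
qed

lemma colouring_inj_on_clique:
  assumes "\<forall>x\<in>S. \<forall>y\<in>S. r x y \<longrightarrow> c x \<noteq> c y" "clique r K" "K \<subseteq> S"
  shows "inj_on c K"
  using assms unfolding inj_on_def clique_def by blast

lemma ex_max_clique:
  assumes "finite V"
  shows "\<exists>K\<subseteq>V. clique r K \<and> (\<forall>L\<subseteq>V. clique r L \<longrightarrow> card L \<le> card K)"
proof -
  have "\<exists>K. (K \<subseteq> V \<and> clique r K) \<and> (\<forall>L. L \<subseteq> V \<and> clique r L \<longrightarrow> card L \<le> card K)"
    by (rule ex_has_greatest_nat[of _ "{}" _ "Suc (card V)"])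
       (use assms card_mono in \<open>auto simp: clique_def less_Suc_eq_le\<close>)
  then show ?thesis by blast
qed

lemma ex_min_imperfect:
  assumes "finite V" "\<not> perfect_on r V"
  obtains H where "H \<subseteq> V" "min_imperfect r H"
proof -
  have "\<exists>H. (H \<subseteq> V \<and> \<not> perfect_on r H) \<and> (\<forall>L. L \<subseteq> V \<and> \<not> perfect_on r L \<longrightarrow> card H \<le> card L)"
    by (rule ex_has_least_nat) (use assms in auto)
  then obtain H where H: "H \<subseteq> V" "\<not> perfect_on r H"
      "\<And>L. L \<subseteq> V \<Longrightarrow> \<not> perfect_on r L \<Longrightarrow> card H \<le> card L" by blast
  have fin: "finite H" using H assms finite_subset by auto
  have "perfect_on r S" if "S \<subset> H" for S
    using H(3)[of S] H(1) that psubset_card_mono[OF fin that] by force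
  then show ?thesis using that H fin by (auto simp: min_imperfect_def)
qed

locale sgraph =
  fixes r :: "'a \<Rightarrow> 'a \<Rightarrow> bool"
  assumes sym: "r x y \<Longrightarrow> r y x" and irr: "\<not> r x x"
begin

lemma sgraph_co: "sgraph (co r)"
  by unfold_locales (auto simp: co_def sym)

lemma co_co: "co (co r) = r"
  by (auto simp: co_def irr fun_eq_iff)

section \<open>The perfect graph theorem\<close>

lemma min_imperfect_critical:
  assumes "min_imperfect r V"
  obtains w where "critical r V w"
proof -
  have fin: "finite V" using assms by (simp add: min_imperfect_def)
  obtain K where K: "K \<subseteq> V" "clique r K" "\<And>L. L \<subseteq> V \<Longrightarrow> clique r L \<Longrightarrow> card L \<le> card K"
    using ex_max_clique[OF fin, of r] by blast
  obtain S k where S: "S \<subseteq> V" "\<forall>K\<subseteq>S. clique r K \<longrightarrow> card K \<le> k" "\<not> colourable_on r S k"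
  proof -
    have "\<not> perfect_on r V" using assms by (simp add: min_imperfect_def)
    then show ?thesis using that unfolding perfect_on_def by blast
  qed
  have "S = V"
  proof (rule ccontr)
    assume "S \<noteq> V"
    then have "perfect_on r S" using S assms by (auto simp: min_imperfect_def)
    then show False using S by (auto simp: perfect_on_def)
  qed
  then have "card K \<le> k" using K S by auto
  have 1: "\<not> colourable_on r V (card K)"
    using colourable_on_mono[of r V "card K" k] S \<open>S = V\<close> \<open>card K \<le> k\<close> by auto
  have 2: "colourable_on r S (card K)" if "S \<subset> V" for S
  proof -
    have "perfect_on r S" using that assms by (auto simp: min_imperfect_def)
    moreover have "\<forall>L\<subseteq>S. clique r L \<longrightarrow> card L \<le> card K" using K(3) that by blast
    ultimately show ?thesis by (auto simp: perfect_on_def)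
  qed
  have "critical r V (card K)" using K 1 2 unfolding critical_def by blast
  then show ?thesis by (rule that)
qed

text \<open>Otherwise the proper subgraph \<open>V - A\<close> is perfect with cliques of size at
  most \<open>w - 1\<close>, so \<open>w - 1\<close> colours suffice there and \<open>A\<close>
  serves as one further colour class.\<close>

lemma ex_clique_avoiding_stable:
  assumes mi: "min_imperfect r V"
    and col: "\<not> colourable_on r V w"
    and ex: "\<exists>K\<subseteq>V. clique r K \<and> card K = w"
    and A: "A \<subseteq> V" "clique (co r) A"
  shows "\<exists>K\<subseteq>V - A. clique r K \<and> w \<le> card K"
proof (cases "A = {}")
  case True
  then show ?thesis using ex by auto
next
  case False
  show ?thesis
  proof (rule ccontr)
    assume no: "\<not> ?thesis"
    have "w > 0"
    proof (rule ccontr)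
      assume "\<not> 0 < w"
      then have "\<exists>K\<subseteq>V - A. clique r K \<and> w \<le> card K"
        by (intro exI[of _ "{}"]) (auto simp: clique_def)
      then show False using no by blast
    qed
    moreover have "\<forall>K\<subseteq>V - A. clique r K \<longrightarrow> card K \<le> w - 1"
    proof (intro allI impI)
      fix K assume "K \<subseteq> V - A" "clique r K"
      then have "\<not> w \<le> card K" using no by blast
      then show "card K \<le> w - 1" by simp
    qed
    moreover have "V - A \<subset> V" using False A by auto
    then have "perfect_on r (V - A)" using mi by (auto simp: min_imperfect_def)
    ultimately have "colourable_on r (V - A) (w - 1)" by (auto simp: perfect_on_def)
    then have "colourable_on r V (Suc (w - 1))"
      using colourable_on_add_stable A irr by metis
    then show False using col \<open>w > 0\<close> by simp
  qed
qed

text \<open>Gasparian's argument: the stable set \<open>A\<close> together with the colour classes of the graphs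
  \<open>V - {s}\<close> for \<open>s \<in> A\<close> is a family of stable sets such that every maximum clique misses exactly
  one of them; so their incidence vectors are linearly independent.\<close>

lemma min_imperfect_card:
  assumes mi: "min_imperfect r V"
    and w: "critical r V w"
    and A: "A \<subseteq> V" "clique (co r) A"
  shows "card A * w < card V"
proof (rule ccontr)
  have max: "\<And>K. K \<subseteq> V \<Longrightarrow> clique r K \<Longrightarrow> card K \<le> w"
    and ex: "\<exists>K\<subseteq>V. clique r K \<and> card K = w"
    and nc: "\<not> colourable_on r V w"
    and sub: "\<And>S. S \<subset> V \<Longrightarrow> colourable_on r S w"
    using w by (auto simp: critical_def)
  assume big: "\<not> card A * w < card V"
  have finV: "finite V" using mi by (simp add: min_imperfect_def)
  have finA: "finite A" using A finV finite_subset by auto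
  have "V \<noteq> {}" using nc by (auto simp: colourable_on_def)
  then have pos: "card A * w > 0" using big finV card_gt_0_iff[of V] by linarith
  have "\<exists>c. \<forall>s\<in>A. (\<forall>x\<in>V - {s}. c s x < w) \<and>
         (\<forall>x\<in>V - {s}. \<forall>y\<in>V - {s}. r x y \<longrightarrow> c s x \<noteq> (c s y :: nat))"
  proof (rule bchoice, rule ballI)
    fix s assume "s \<in> A"
    then have "V - {s} \<subset> V" using A by auto
    then show "\<exists>c. (\<forall>x\<in>V - {s}. c x < w) \<and>
         (\<forall>x\<in>V - {s}. \<forall>y\<in>V - {s}. r x y \<longrightarrow> c x \<noteq> (c y :: nat))"
      using sub[of "V - {s}"] by (simp add: colourable_on_def)
  qed
  then obtain c where "\<forall>s\<in>A. (\<forall>x\<in>V - {s}. c s x < w) \<and>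
         (\<forall>x\<in>V - {s}. \<forall>y\<in>V - {s}. r x y \<longrightarrow> c s x \<noteq> (c s y :: nat))" ..
  then have c: "\<And>s x. s \<in> A \<Longrightarrow> x \<in> V - {s} \<Longrightarrow> c s x < w"
     "\<And>s. s \<in> A \<Longrightarrow> \<forall>x\<in>V - {s}. \<forall>y\<in>V - {s}. r x y \<longrightarrow> c s x \<noteq> c s y"
    by auto
  \<comment> \<open>\<open>None\<close> stands for \<open>A\<close>, and \<open>Some (s, k)\<close>
    for colour class \<open>k\<close> of \<open>V - {s}\<close>: one set more than
    \<open>card A * w\<close>, hence more sets than vertices.\<close>
  define I where "I = insert None (Some ` (A \<times> {..<w}))"
  define St where "St = (\<lambda>i. case i of None \<Rightarrow> A | Some (s, k) \<Rightarrow> {x\<in>V - {s}. c s x = k})"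
  have finI: "finite I" by (simp add: I_def finA)
  have cardI: "card I = Suc (card A * w)"
    by (simp add: I_def finA card_insert_if card_image inj_on_def card_cartesian_product)
  have St: "St i \<subseteq> V" "clique (co r) (St i)" if i: "i \<in> I" for i
  proof -
    show "St i \<subseteq> V" using A by (auto simp: St_def split: option.split)
    show "clique (co r) (St i)"
    proof (cases i)
      case None
      then show ?thesis using A by (simp add: St_def)
    next
      case (Some q)
      then obtain s k where q: "i = Some (s, k)" "s \<in> A" using i by (auto simp: I_def)
      have "\<not> r x y" if "x \<in> St i" "y \<in> St i" for x y
        using that c(2)[OF q(2), rule_format, of x y] by (auto simp: q St_def)
      then show ?thesis by (simp add: clique_def co_def)
    qed
  qed
  have "\<exists>Q. \<forall>i\<in>I. Q i \<subseteq> V - St i \<and> clique r (Q i) \<and> card (Q i) = w"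
  proof (rule bchoice, rule ballI)
    fix i assume i: "i \<in> I"
    have "\<exists>K\<subseteq>V - St i. clique r K \<and> w \<le> card K"
      by (rule ex_clique_avoiding_stable[OF mi nc ex St[OF i]])
    then obtain K where "K \<subseteq> V - St i" "clique r K" "w \<le> card K" by blast
    then show "\<exists>K. K \<subseteq> V - St i \<and> clique r K \<and> card K = w"
      using max[of K] by (intro exI[of _ K]) auto
  qed
  then obtain Q where "\<forall>i\<in>I. Q i \<subseteq> V - St i \<and> clique r (Q i) \<and> card (Q i) = w" ..
  then have Q: "\<And>i. i \<in> I \<Longrightarrow> Q i \<subseteq> V - St i" "\<And>i. i \<in> I \<Longrightarrow> clique r (Q i)"
     "\<And>i. i \<in> I \<Longrightarrow> card (Q i) = w" by auto
  \<comment> \<open>A clique of size \<open>w\<close> avoiding \<open>s\<close> uses all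
    \<open>w\<close> colours of \<open>V - {s}\<close>.\<close>
  have surj: "\<exists>x\<in>K. c s x = k" if "s \<in> A" "k < w" "K \<subseteq> V - {s}" "clique r K" "card K = w" for s k K
  proof -
    have "inj_on (c s) K" by (rule colouring_inj_on_clique[OF c(2)[OF that(1)] that(4,3)])
    then have "card (c s ` K) = w" using card_image[of "c s" K] that(5) by simp
    moreover have "c s ` K \<subseteq> {..<w}" using c(1) that by auto
    ultimately have "c s ` K = {..<w}" by (intro card_subset_eq) auto
    then have "k \<in> c s ` K" using that by auto
    then show ?thesis by blast
  qed
  have unique: "i = j" if i: "i \<in> I" and j: "j \<in> I" and K: "K \<subseteq> V" "clique r K" "card K = w"
      and mi: "K \<inter> St i = {}" and mj: "K \<inter> St j = {}" for i j K
  proof -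
    have fK: "finite K" using K finV finite_subset by auto
    have one: "\<And>s t. s \<in> K \<Longrightarrow> t \<in> K \<Longrightarrow> s \<in> A \<Longrightarrow> t \<in> A \<Longrightarrow> s = t"
      using clique_stable_unique[OF K(2) A(2)] by simp
    \<comment> \<open>So a clique of size \<open>w\<close> that misses a colour class of
      \<open>V - {s}\<close> contains \<open>s\<close>. As it meets \<open>A\<close> at most once,
      this determines \<open>s\<close>.\<close>
    have inK: "s \<in> K" if "s \<in> A" "k < w" "K \<inter> St (Some (s, k)) = {}" for s k
    proof (rule ccontr)
      assume "s \<notin> K"
      then have "\<exists>x\<in>K. c s x = k" using surj[OF that(1,2) _ K(2,3)] K(1) by blast
      then show False using that(3) K \<open>s \<notin> K\<close> by (auto simp: St_def)
    qed
    show ?thesis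
    proof (cases i)
      case None
      show ?thesis
      proof (cases j)
        case (Some q)
        then obtain s k where q: "j = Some (s, k)" "s \<in> A" "k < w" using j by (auto simp: I_def)
        then show ?thesis using inK[of s k] mi mj None by (auto simp: St_def)
      qed (use None in simp)
    next
      case (Some q)
      then obtain s k where q: "i = Some (s, k)" "s \<in> A" "k < w" using i by (auto simp: I_def)
      have sK: "s \<in> K" using inK q mi by auto
      show ?thesis
      proof (cases j)
        case None
        then show ?thesis using mj sK q by (auto simp: St_def)
      next
        case (Some q')
        then obtain t m where q': "j = Some (t, m)" "t \<in> A" "m < w" using j by (auto simp: I_def)
        then have "t \<in> K" using inK mj by auto
        then have "t = s" using one sK q q' by auto
        \<comment> \<open>Two missed classes would leave \<open>w - 2\<close> colours for the
          \<open>w - 1\<close> vertices of \<open>K - {s}\<close>.\<close>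
        have "m = k"
        proof (rule ccontr)
          assume "m \<noteq> k"
          let ?L = "K - {s}"
          have LV: "?L \<subseteq> V - {s}" using K by auto
          have "inj_on (c s) ?L"
            by (rule colouring_inj_on_clique[where r = r, OF _ clique_subset[OF K(2)] LV])
               (use c(2) q in auto)
          then have "card (c s ` ?L) = w - 1" using card_image sK K fK by fastforce
          moreover have "c s ` ?L \<subseteq> {..<w} - {m, k}"
          proof
            fix z assume "z \<in> c s ` ?L"
            then obtain x where x: "x \<in> K" "x \<noteq> s" "z = c s x" by auto
            then have "z < w" using c(1) q K by auto
            moreover have "z \<noteq> k" "z \<noteq> m"
              using x mi mj q q' \<open>t = s\<close> K by (auto simp: St_def)
            ultimately show "z \<in> {..<w} - {m, k}" by auto
          qed
          then have "card (c s ` ?L) \<le> card ({..<w} - {m, k})" by (intro card_mono) auto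
          moreover have "card ({..<w} - {m, k}) = w - 2"
            using \<open>m \<noteq> k\<close> q q' by (subst card_Diff_subset) auto
          ultimately show False using q q' \<open>m \<noteq> k\<close> by linarith
        qed
        then show ?thesis using q q' \<open>t = s\<close> by simp
      qed
    qed
  qed
  have cap: "card (Q j \<inter> St i) = (if i = j then 0 else 1)" if "i \<in> I" "j \<in> I" for i j
  proof (cases "i = j")
    case True
    then have "Q j \<inter> St i = {}" using Q(1) that by auto
    then show ?thesis using True by simp
  next
    case False
    have "Q j \<inter> St j = {}" using Q(1) that by auto
    then have "Q j \<inter> St i \<noteq> {}" using unique[of i j "Q j"] Q that False by blast
    then obtain x where x: "x \<in> Q j \<inter> St i" by blast
    have "y = x" if "y \<in> Q j \<inter> St i" for y
      using clique_stable_unique[OF Q(2)[OF \<open>j \<in> I\<close>] St(2)[OF \<open>i \<in> I\<close>]] that x by blast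
    then have "Q j \<inter> St i = {x}" using x by blast
    then show ?thesis using False by simp
  qed
  have "card V < card I" using big cardI by simp
  then obtain l where l: "\<exists>i\<in>I. l i \<noteq> 0"
      "\<forall>x\<in>V. (\<Sum>i\<in>I. l i * (if x \<in> St i then 1 else 0 :: real)) = 0"
    using underdetermined_linear_system[OF finV finI, of "\<lambda>i x. if x \<in> St i then 1 else 0"] by blast
  define L where "L = (\<Sum>i\<in>I. l i)"
  \<comment> \<open>Sum the dependence over the vertices of \<open>Q j\<close>. By
    \<open>cap\<close> the intersection matrix is all ones minus the identity, so the result reads
    \<open>L - l j = 0\<close>.\<close>
  have lL: "l j = L" if j: "j \<in> I" for j
  proof -
    have finQ: "finite (Q j)" using Q(1)[OF j] finV finite_subset by auto
    have "0 = (\<Sum>x\<in>Q j. \<Sum>i\<in>I. l i * (if x \<in> St i then 1 else 0))"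
      using l Q(1)[OF j] by (intro sum.neutral[symmetric]) auto
    also have "\<dots> = (\<Sum>i\<in>I. \<Sum>x\<in>Q j. l i * (if x \<in> St i then 1 else 0))" by (rule sum.swap)
    also have "\<dots> = (\<Sum>i\<in>I. l i * real (card (Q j \<inter> St i)))"
    proof (rule sum.cong)
      fix i
      have "(\<Sum>x\<in>Q j. l i * (if x \<in> St i then 1 else 0)) = l i * (\<Sum>x\<in>Q j. if x \<in> St i then 1 else 0)"
        by (rule sum_distrib_left[symmetric])
      also have "(\<Sum>x\<in>Q j. if x \<in> St i then 1 else 0) = (\<Sum>x\<in>Q j \<inter> St i. (1::real))"
        by (rule sum.inter_restrict[OF finQ, symmetric])
      finally show "(\<Sum>x\<in>Q j. l i * (if x \<in> St i then 1 else 0)) = l i * real (card (Q j \<inter> St i))"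
        by simp
    qed simp
    also have "\<dots> = (\<Sum>i\<in>I. if i = j then 0 else l i)"
      by (rule sum.cong) (use cap j in auto)
    also have "\<dots> = (\<Sum>i\<in>I - {j}. l i)"
      by (rule sum.mono_neutral_cong_right) (use finI in auto)
    also have "\<dots> = L - l j" using finI j by (simp add: L_def sum_diff1)
    finally show ?thesis by simp
  qed
  \<comment> \<open>All coefficients equal their own sum, and there are more than one of them, so
    they vanish.\<close>
  have "L = (\<Sum>i\<in>I. l i)" by (simp only: L_def)
  also have "\<dots> = (\<Sum>i\<in>I. L)" by (rule sum.cong[OF refl lL])
  also have "\<dots> = L + real (card A * w) * L" by (simp add: cardI algebra_simps)
  finally have "L = 0" using pos by simp
  then show False using l(1) lL by force
qed

lemma colour_class_stable:
  "\<forall>x\<in>S. \<forall>y\<in>S. r x y \<longrightarrow> c x \<noteq> c y \<Longrightarrow> clique (co r) {x\<in>S. c x = i}"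
  unfolding clique_def co_def by blast

text \<open>Lovasz's theorem. In a minimal imperfect \<open>H\<close> of the complement the counting
  bound gives \<open>card K * w < card H\<close>, where \<open>K\<close> is a maximum clique of
  \<open>r\<close> and \<open>w\<close> bounds its stable sets. But \<open>r\<close> is perfect, so
  \<open>card K\<close> stable sets of size at most \<open>w\<close> cover \<open>H\<close>.\<close>

lemma perfect_on_co:
  assumes "finite V" "perfect_on r V"
  shows "perfect_on (co r) V"
proof (rule ccontr)
  assume "\<not> perfect_on (co r) V"
  then obtain H where H: "H \<subseteq> V" "min_imperfect (co r) H"
    using ex_min_imperfect[OF assms(1)] by metis
  interpret c: sgraph "co r" by (rule sgraph_co)
  have finH: "finite H" using H by (simp add: min_imperfect_def)
  obtain w where w: "critical (co r) H w" using c.min_imperfect_critical[OF H(2)] .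
  obtain K where K: "K \<subseteq> H" "clique r K" "\<forall>L\<subseteq>H. clique r L \<longrightarrow> card L \<le> card K"
    using ex_max_clique[OF finH, of r] by blast
  have less: "card K * w < card H"
    by (rule c.min_imperfect_card[OF H(2) w K(1)]) (simp add: co_co K)
  have "colourable_on r H (card K)"
    using assms(2) H(1) K(3) by (simp add: perfect_on_def)
  then obtain c :: "'a \<Rightarrow> nat" where c: "\<forall>x\<in>H. c x < card K" "\<forall>x\<in>H. \<forall>y\<in>H. r x y \<longrightarrow> c x \<noteq> c y"
    by (auto simp: colourable_on_def)
  have "H = (\<Union>i<card K. {x\<in>H. c x = i})" using c by auto
  then have "card H \<le> (\<Sum>i<card K. card {x\<in>H. c x = i})"
    by (metis card_UN_le finite_lessThan)
  also have "\<dots> \<le> (\<Sum>i<card K. w)"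
  proof (rule sum_mono)
    fix i
    show "card {x\<in>H. c x = i} \<le> w"
      using w colour_class_stable[OF c(2), of i] by (auto simp: critical_def)
  qed
  finally show False using less by simp
qed

lemma min_imperfect_co:
  assumes "min_imperfect r V"
  shows "min_imperfect (co r) V"
proof -
  interpret c: sgraph "co r" by (rule sgraph_co)
  have fin: "finite V" using assms by (simp add: min_imperfect_def)
  have "\<not> perfect_on (co r) V"
    using c.perfect_on_co[OF fin] assms by (auto simp: co_co min_imperfect_def)
  moreover have "perfect_on (co r) S" if "S \<subset> V" for S
    using perfect_on_co[of S] that assms fin finite_subset by (auto simp: min_imperfect_def)
  ultimately show ?thesis using fin by (simp add: min_imperfect_def)
qed

text \<open>If \<open>s\<close> is any vertex, then all colour classes of \<open>V - {s}\<close> are maximum stable sets, and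
  a maximum stable set meeting \<open>X\<close> meets it in a maximum stable set of \<open>X\<close>, of size \<open>t\<close> say.
  So \<open>t\<close> divides \<open>card (X - {s})\<close>, both for \<open>s\<close> in \<open>X\<close> and for \<open>s\<close> outside.\<close>

lemma homogeneous_min_imperfect_clique:
  assumes mi: "min_imperfect r V" and X: "homogeneous r V X" "X \<noteq> V"
  shows "clique r X"
proof (cases "X = {}")
  case True
  then show ?thesis by (simp add: clique_def)
next
  case False
  have finV: "finite V" using mi by (simp add: min_imperfect_def)
  have XV: "X \<subseteq> V" using X by (simp add: homogeneous_def)
  have hom: "r u a \<Longrightarrow> r u b" if "u \<in> V - X" "a \<in> X" "b \<in> X" for u a b
    using X that by (auto simp: homogeneous_def)
  have finX: "finite X" using XV finV finite_subset by auto
  obtain w where cr: "critical r V w" using min_imperfect_critical[OF mi] .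
  have w: "\<not> colourable_on r V w" "\<And>S. S \<subset> V \<Longrightarrow> colourable_on r S w"
    using cr by (auto simp: critical_def)
  obtain A where A: "A \<subseteq> V" "clique (co r) A" "\<forall>L\<subseteq>V. clique (co r) L \<longrightarrow> card L \<le> card A"
    using ex_max_clique[OF finV, of "co r"] by blast
  obtain T where T: "T \<subseteq> X" "clique (co r) T" "\<forall>L\<subseteq>X. clique (co r) L \<longrightarrow> card L \<le> card T"
    using ex_max_clique[OF finX, of "co r"] by blast
  have big: "card A * w < card V" by (rule min_imperfect_card[OF mi cr A(1,2)])
  \<comment> \<open>Exchange: a vertex of \<open>B - X\<close> misses a vertex of \<open>X\<close>,
    hence all of \<open>X\<close>, so replacing \<open>B \<inter> X\<close> by \<open>T\<close>
    keeps \<open>B\<close> stable.\<close>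
  have meet: "card (B \<inter> X) = card T"
    if B: "B \<subseteq> V" "clique (co r) B" "card B = card A" "B \<inter> X \<noteq> {}" for B
  proof (rule antisym)
    have finB: "finite B" using B finV finite_subset by auto
    show "card (B \<inter> X) \<le> card T" using T(3) B(2) clique_subset[of "co r" B "B \<inter> X"] by auto
    obtain b where b: "b \<in> B" "b \<in> X" using B by auto
    let ?B = "(B - X) \<union> T"
    have cross: "co r x y \<and> co r y x" if x: "x \<in> B - X" and y: "y \<in> T" for x y
    proof -
      have "\<not> r x b" using B(2) x b by (auto simp: clique_def co_def)
      then have "\<not> r x y" using hom[of x y b] x y b T(1) B(1) by auto
      then show ?thesis using sym x y T(1) by (auto simp: co_def)
    qed
    have "clique (co r) ?B"
      using cross B(2) T(2) unfolding clique_def by (metis DiffD1 Un_iff)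
    moreover have "?B \<subseteq> V" using B T XV by auto
    ultimately have "card ?B \<le> card B" using A(3) B(3) by simp
    moreover have "card ?B = card (B - X) + card T"
      using T(1) finB finX finite_subset by (intro card_Un_disjoint) auto
    moreover have "card B = card (B - X) + card (B \<inter> X)"
      using card_Int_Diff[OF finB, of X] by simp
    ultimately show "card T \<le> card (B \<inter> X)" by simp
  qed
  have dvd: "card T dvd card (X - {s})" if s: "s \<in> V" for s
  proof -
    have "colourable_on r (V - {s}) w" using w(2)[of "V - {s}"] s by auto
    then obtain c :: "'a \<Rightarrow> nat" where c: "\<forall>x\<in>V - {s}. c x < w"
        "\<forall>x\<in>V - {s}. \<forall>y\<in>V - {s}. r x y \<longrightarrow> c x \<noteq> c y"
      by (auto simp: colourable_on_def)
    define Cl where "Cl = (\<lambda>i. {x\<in>V - {s}. c x = i})"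
    have Cl: "Cl i \<subseteq> V" "clique (co r) (Cl i)" for i
      using colour_class_stable[OF c(2)] by (auto simp: Cl_def)
    have le: "card (Cl i) \<le> card A" for i using A(3) Cl by blast
    have split: "card Y = (\<Sum>i<w. card (Cl i \<inter> Y))" if "Y \<subseteq> V - {s}" for Y
    proof -
      have "Y = (\<Union>i<w. Cl i \<inter> Y)" using that c(1) by (auto simp: Cl_def)
      moreover have "card (\<Union>i<w. Cl i \<inter> Y) = (\<Sum>i<w. card (Cl i \<inter> Y))"
        by (rule card_UN_disjoint) (use finV that finite_subset in \<open>auto simp: Cl_def\<close>)
      ultimately show ?thesis by simp
    qed
    \<comment> \<open>The \<open>w\<close> classes cover \<open>card V - 1 \<ge> card A * w\<close>
      vertices, so none can be smaller than \<open>card A\<close>.\<close>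
    have eq: "card (Cl i) = card A" if "i < w" for i
    proof (rule ccontr)
      assume "card (Cl i) \<noteq> card A"
      then have lt: "card (Cl i) < card A" using le[of i] by simp
      have "Cl j \<inter> (V - {s}) = Cl j" for j by (auto simp: Cl_def)
      then have "card (V - {s}) = (\<Sum>i<w. card (Cl i))" using split[of "V - {s}"] by simp
      also have "\<dots> < (\<Sum>i<w. card A)"
        by (rule sum_strict_mono_ex1) (use le lt that in auto)
      finally show False using big s finV by (simp add: mult.commute)
    qed
    have "card (X - {s}) = (\<Sum>i<w. card (Cl i \<inter> (X - {s})))" by (rule split) (use XV in auto)
    also have "(\<lambda>i. Cl i \<inter> (X - {s})) = (\<lambda>i. Cl i \<inter> X)" by (auto simp: Cl_def)
    then have "(\<Sum>i<w. card (Cl i \<inter> (X - {s}))) = (\<Sum>i<w. card (Cl i \<inter> X))" by metis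
    finally have sum: "card (X - {s}) = (\<Sum>i<w. card (Cl i \<inter> X))" .
    show ?thesis unfolding sum
    proof (rule dvd_sum)
      fix i assume "i \<in> {..<w}"
      then show "card T dvd card (Cl i \<inter> X)"
        using meet[OF Cl eq] by (cases "Cl i \<inter> X = {}") auto
    qed
  qed
  obtain x where x: "x \<in> X" using False by auto
  obtain u where u: "u \<in> V - X" using X XV by auto
  have "X - {u} = X" using u by auto
  then have "card T dvd card X" using dvd[of u] u by simp
  moreover have "card X = Suc (card (X - {x}))" using card.remove[OF finX x] .
  ultimately have "card T dvd Suc (card (X - {x}))" by simp
  moreover have "card T dvd card (X - {x})" using dvd[of x] x XV by auto
  \<comment> \<open>\<open>card T\<close> divides two consecutive numbers.\<close>
  ultimately have T1: "card T = 1"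
    by (metis dvd_add_right_iff nat_dvd_1_iff_1 plus_1_eq_Suc add.commute)
  show ?thesis unfolding clique_def
  proof (intro ballI impI, rule ccontr)
    fix x y assume xy: "x \<in> X" "y \<in> X" "x \<noteq> y" "\<not> r x y"
    then have "clique (co r) {x, y}" using sym by (auto simp: clique_def co_def)
    then show False using T(3)[rule_format, of "{x, y}"] xy T1 by auto
  qed
qed

section \<open>Primality, star cutsets and domination\<close>

lemma homogeneous_co: "homogeneous r V X \<Longrightarrow> homogeneous (co r) V X"
  unfolding homogeneous_def co_def by blast

lemma prime_on_co: "prime_on r V \<Longrightarrow> prime_on (co r) V"
  using sgraph.homogeneous_co[OF sgraph_co] unfolding prime_on_def co_co by blast

text \<open>A proper homogeneous set is a clique, and by the same result in the complement also
  stable, which leaves at most one vertex.\<close>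

lemma min_imperfect_prime:
  assumes "min_imperfect r V"
  shows "prime_on r V"
  unfolding prime_on_def
proof (intro conjI allI impI)
  show "finite V" using assms by (simp add: min_imperfect_def)
  fix X assume X: "homogeneous r V X \<and> 2 \<le> card X"
  interpret c: sgraph "co r" by (rule sgraph_co)
  show "X = V"
  proof (rule ccontr)
    assume "X \<noteq> V"
    then have "clique r X" "clique (co r) X"
      using homogeneous_min_imperfect_clique[OF assms] X
        c.homogeneous_min_imperfect_clique[OF min_imperfect_co[OF assms] homogeneous_co] by auto
    then have "x = y" if "x \<in> X" "y \<in> X" for x y
      using clique_stable_unique[of r X X x y] that by simp
    moreover obtain x where "x \<in> X" using X by (cases "X = {}") auto
    ultimately have "X = {x}" by blast
    then show False using X by simp
  qed
qed

text \<open>Chvatal's star cutset lemma, with cutset \<open>C\<close>, centre \<open>v\<close> and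
  sides \<open>A\<close>, \<open>B\<close>. In \<open>w\<close>-colourings of
  \<open>A \<union> C\<close> and \<open>B \<union> C\<close> the colour of \<open>v\<close> occurs
  on \<open>C\<close> only at \<open>v\<close>, so the two colour classes of \<open>v\<close> unite
  to a stable set \<open>S\<close>. Every clique lies on one side, hence \<open>V - S\<close> has
  clique number below \<open>w\<close> and is coloured with \<open>w - 1\<close> colours.\<close>

lemma min_imperfect_no_star_cutset:
  assumes mi: "min_imperfect r V"
    and V: "V = A \<union> B \<union> C" "A \<inter> B = {}" "A \<inter> C = {}" "B \<inter> C = {}" "A \<noteq> {}" "B \<noteq> {}"
    and anti: "\<And>a b. a \<in> A \<Longrightarrow> b \<in> B \<Longrightarrow> \<not> r a b"
    and v: "v \<in> C" "\<And>x. x \<in> C \<Longrightarrow> x \<noteq> v \<Longrightarrow> r v x"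
  shows False
proof -
  obtain w where cr: "critical r V w" using min_imperfect_critical[OF mi] .
  have w: "\<not> colourable_on r V w" "\<And>S. S \<subset> V \<Longrightarrow> colourable_on r S w"
    using cr by (auto simp: critical_def)
  have finV: "finite V" using mi by (simp add: min_imperfect_def)
  have sub: "A \<union> C \<subset> V" "B \<union> C \<subset> V" using V by auto
  obtain c :: "'a \<Rightarrow> nat" where c: "\<forall>x\<in>A \<union> C. c x < w"
      "\<forall>x\<in>A \<union> C. \<forall>y\<in>A \<union> C. r x y \<longrightarrow> c x \<noteq> c y"
    using w(2)[OF sub(1)] by (auto simp: colourable_on_def)
  obtain d :: "'a \<Rightarrow> nat" where d: "\<forall>x\<in>B \<union> C. d x < w"
      "\<forall>x\<in>B \<union> C. \<forall>y\<in>B \<union> C. r x y \<longrightarrow> d x \<noteq> d y"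
    using w(2)[OF sub(2)] by (auto simp: colourable_on_def)
  define S where "S = {x\<in>A \<union> C. c x = c v} \<union> {x\<in>B \<union> C. d x = d v}"
  have "c x \<noteq> c v \<and> d x \<noteq> d v" if "x \<in> C" "x \<noteq> v" for x
    using c(2)[rule_format, of v x] d(2)[rule_format, of v x] v that by auto
  then have Sv: "S \<inter> C = {v}" using v(1) unfolding S_def by blast
  have SA: "S \<inter> A = {x\<in>A. c x = c v}" and SB: "S \<inter> B = {x\<in>B. d x = d v}"
    using V by (auto simp: S_def)
  have stable: "\<not> r x y" if x: "x \<in> S" and y: "y \<in> S" for x y
  proof -
    have *: "x \<in> A \<and> c x = c v \<or> x \<in> B \<and> d x = d v \<or> x = v" if "x \<in> S" for x
      using that Sv unfolding S_def by blast
    have cc: "\<not> r x y" if "x \<in> A \<union> C" "y \<in> A \<union> C" "c x = c y" for x y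
      using c(2) that by auto
    have dd: "\<not> r x y" if "x \<in> B \<union> C" "y \<in> B \<union> C" "d x = d y" for x y
      using d(2) that by auto
    show ?thesis using *[OF x] *[OF y] cc[of x y] dd[of x y] anti[of x y] anti[of y x] sym[of x y] v(1)
      irr[of v] by auto
  qed
  have wpos: "w > 0" using c(1) v by fastforce
  have "\<forall>K\<subseteq>V - S. clique r K \<longrightarrow> card K \<le> w - 1"
  proof (intro allI impI)
    fix K assume K: "K \<subseteq> V - S" "clique r K"
    have bound: "card K \<le> w - 1" if "K \<subseteq> D" "v \<in> D" "\<forall>x\<in>D. f x < w"
      "\<forall>x\<in>D. \<forall>y\<in>D. r x y \<longrightarrow> f x \<noteq> f y" "\<forall>x\<in>K. f x \<noteq> f v" for D and f :: "'a \<Rightarrow> nat"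
    proof -
      have "inj_on f K" by (rule colouring_inj_on_clique[OF that(4) K(2) that(1)])
      then have "card K = card (f ` K)" by (simp add: card_image)
      also have "\<dots> \<le> card ({..<w} - {f v})" by (rule card_mono) (use that in auto)
      also have "\<dots> = w - 1" using that by auto
      finally show ?thesis .
    qed
    have "K \<subseteq> A \<union> C \<or> K \<subseteq> B \<union> C"
    proof (rule ccontr)
      assume "\<not> ?thesis"
      then obtain a b where "a \<in> K" "a \<in> A" "b \<in> K" "b \<in> B" using K(1) V(1) by auto
      moreover have "a \<noteq> b" using calculation V by auto
      ultimately show False using K(2) anti by (auto simp: clique_def)
    qed
    then show "card K \<le> w - 1"
    proof
      assume "K \<subseteq> A \<union> C"
      moreover have "\<forall>x\<in>K. c x \<noteq> c v" using K(1) calculation by (auto simp: S_def)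
      ultimately show ?thesis using bound[of "A \<union> C" c] c v(1) by auto
    next
      assume "K \<subseteq> B \<union> C"
      moreover have "\<forall>x\<in>K. d x \<noteq> d v" using K(1) calculation by (auto simp: S_def)
      ultimately show ?thesis using bound[of "B \<union> C" d] d v(1) by auto
    qed
  qed
  moreover have "v \<in> S" using Sv by blast
  then have "V - S \<subset> V" using V(1) v(1) by blast
  then have "perfect_on r (V - S)"
    using mi by (simp add: min_imperfect_def)
  ultimately have "colourable_on r (V - S) (w - 1)" by (simp add: perfect_on_def)
  moreover have "clique (co r) S" using stable by (auto simp: clique_def co_def)
  ultimately have "colourable_on r V (Suc (w - 1))"
    by (rule colourable_on_add_stable[OF _ _ irr])
  then show False using w(1) wpos by simp
qed

text \<open>In a colouring of \<open>V - {v}\<close>, the colour of \<open>m\<close> is free for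
  \<open>v\<close>, because every neighbour of \<open>v\<close> is a neighbour of
  \<open>m\<close>.\<close>

lemma min_imperfect_no_domination:
  assumes mi: "min_imperfect r V" and v: "v \<in> V" "m \<in> V" "m \<noteq> v" "\<not> r v m"
    and dom: "\<And>x. x \<in> V \<Longrightarrow> r v x \<Longrightarrow> r m x"
  shows False
proof -
  obtain w where cr: "critical r V w" using min_imperfect_critical[OF mi] .
  have w: "\<not> colourable_on r V w" "\<And>S. S \<subset> V \<Longrightarrow> colourable_on r S w"
    using cr by (auto simp: critical_def)
  obtain c :: "'a \<Rightarrow> nat" where c: "\<forall>x\<in>V - {v}. c x < w"
      "\<forall>x\<in>V - {v}. \<forall>y\<in>V - {v}. r x y \<longrightarrow> c x \<noteq> c y"
    using w(2)[of "V - {v}"] v by (auto simp: colourable_on_def)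
  let ?c = "c(v := c m)"
  have 1: "?c x < w" if "x \<in> V" for x using c(1) v that by auto
  have 2: "?c x \<noteq> ?c y" if "x \<in> V" "y \<in> V" "r x y" for x y
  proof -
    have "x \<noteq> y" using that irr by auto
    consider "x = v" "y \<noteq> v" | "x \<noteq> v" "y = v" | "x \<noteq> v" "y \<noteq> v" using \<open>x \<noteq> y\<close> by blast
    then show ?thesis
    proof cases
      case 1
      then have "r m y" using dom that by auto
      then show ?thesis using c(2) 1 that v by auto
    next
      case 2
      then have "r m x" using dom sym that by auto
      then show ?thesis using c(2) 2 that v by force
    next
      case 3
      then show ?thesis using c(2) that by auto
    qed
  qed
  show False using w(1) 1 2 unfolding colourable_on_def by blast
qed

end

section \<open>Induced paths and cycles\<close>

text \<open>\<open>k\<close> counts the edges; the path has \<open>k + 1\<close> vertices.\<close>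

definition induced_path :: "('a \<Rightarrow> 'a \<Rightarrow> bool) \<Rightarrow> (nat \<Rightarrow> 'a) \<Rightarrow> nat \<Rightarrow> bool" where
  "induced_path r p k \<longleftrightarrow> inj_on p {..k} \<and>
     (\<forall>i\<le>k. \<forall>j\<le>k. r (p i) (p j) \<longleftrightarrow> j = Suc i \<or> i = Suc j)"

text \<open>An induced cycle of length \<open>n\<close>, as an \<open>n\<close>-periodic sequence of vertices.\<close>

definition induced_cycle :: "('a \<Rightarrow> 'a \<Rightarrow> bool) \<Rightarrow> (nat \<Rightarrow> 'a) \<Rightarrow> nat \<Rightarrow> bool" where
  "induced_cycle r g n \<longleftrightarrow> 0 < n \<and> (\<forall>i j. g i = g j \<longleftrightarrow> i mod n = j mod n) \<and>
     (\<forall>i j. r (g i) (g j) \<longleftrightarrow> Suc i mod n = j mod n \<or> Suc j mod n = i mod n)"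

lemma conn_boundary_edge:
  assumes "conn r X" "a \<in> X" "b \<in> X" "P a" "\<not> P b"
  shows "\<exists>x\<in>X. \<exists>y\<in>X. P x \<and> \<not> P y \<and> r x y"
proof -
  let ?A = "{x\<in>X. P x}"
  have "?A \<subseteq> X" "?A \<noteq> {} \<and> ?A \<noteq> X" using assms(2-5) by auto
  then have "\<exists>x\<in>?A. \<exists>y\<in>X - ?A. r x y"
    using assms(1)[unfolded conn_def, rule_format, of ?A] by simp
  then show ?thesis by auto
qed

lemma conn_singleton: "conn r {x}"
  by (auto simp: conn_def)

text \<open>A walk with the fewest steps from \<open>A\<close> to \<open>B\<close> has no chord, no
  repeated vertex and no interior visit to \<open>A\<close> or \<open>B\<close>, since each of these
  shortens it.\<close>

lemma (in sgraph) shortest_path: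
  assumes conn: "conn r X" and sub: "A \<subseteq> X" "B \<subseteq> X" "A \<noteq> {}" "B \<noteq> {}"
  shows "\<exists>p k. induced_path r p k \<and> (\<forall>i\<le>k. p i \<in> X) \<and> p 0 \<in> A \<and> p k \<in> B \<and>
    (\<forall>i\<le>k. p i \<in> A \<longrightarrow> i = 0) \<and> (\<forall>i\<le>k. p i \<in> B \<longrightarrow> i = k)"
proof -
  define walk where "walk = (\<lambda>p k b. (\<forall>i\<le>k. p i \<in> X) \<and> p 0 \<in> A \<and> p k = b \<and> (\<forall>i<k. r (p i) (p (Suc i))))"
  have reach: "\<exists>p k. walk p k x" if "x \<in> X" for x
  proof (rule ccontr)
    assume no: "\<nexists>p k. walk p k x"
    obtain a where a: "a \<in> A" using sub by auto
    have "walk (\<lambda>_. a) 0 a" using a sub by (auto simp: walk_def)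
    then have "\<exists>p k. walk p k a" by blast
    moreover have "a \<in> X" using a sub by blast
    ultimately have "\<exists>u\<in>X. \<exists>v\<in>X. (\<exists>p k. walk p k u) \<and> \<not> (\<exists>p k. walk p k v) \<and> r u v"
      using conn_boundary_edge[OF conn, of a x "\<lambda>x. \<exists>p k. walk p k x"] that no by simp
    then obtain u v where uv: "u \<in> X" "v \<in> X" "\<exists>p k. walk p k u" "\<not> (\<exists>p k. walk p k v)" "r u v"
      by (elim bexE conjE)
    then obtain p k where "walk p k u" by blast
    then have "walk (p(Suc k := v)) (Suc k) v"
      using uv(2,5) by (auto simp: walk_def less_Suc_eq le_Suc_eq)
    then show False using uv(4) by blast
  qed
  define W where "W = (\<lambda>k. \<exists>p. walk p k (p k) \<and> p k \<in> B)"
  obtain b where "b \<in> B" using sub by auto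
  then have "\<exists>k. W k" using reach[of b] sub unfolding W_def walk_def by blast
  then obtain k where k: "W k" "\<And>m. m < k \<Longrightarrow> \<not> W m"
    using exists_least_iff[of W] by blast
  obtain p where p: "\<forall>i\<le>k. p i \<in> X" "p 0 \<in> A" "\<forall>i<k. r (p i) (p (Suc i))" "p k \<in> B"
    using k(1) by (auto simp: W_def walk_def)
  have iA: "i = 0" if "i \<le> k" "p i \<in> A" for i
  proof (rule ccontr)
    assume "i \<noteq> 0"
    moreover have "W (k - i)" unfolding W_def walk_def
      by (rule exI[of _ "\<lambda>m. p (m + i)"]) (use p that in auto)
    ultimately show False using k(2)[of "k - i"] that by auto
  qed
  have iB: "i = k" if "i \<le> k" "p i \<in> B" for i
  proof (rule ccontr)
    assume "i \<noteq> k"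
    moreover have "W i" unfolding W_def walk_def
      by (rule exI[of _ p]) (use p that in auto)
    ultimately show False using k(2)[of i] that by auto
  qed
  \<comment> \<open>A forward edge from position \<open>i\<close> to \<open>i + d + 1\<close> lets
    the walk skip \<open>d\<close> vertices.\<close>
  have shortcut: "d = 0" if ij: "i + d < k" "r (p i) (p (Suc (i + d)))" for i d
  proof (rule ccontr)
    assume "d \<noteq> 0"
    let ?q = "\<lambda>m. if m \<le> i then p m else p (m + d)"
    have "W (k - d)" unfolding W_def walk_def
    proof (intro exI[of _ ?q] conjI allI impI)
      fix m assume "m < k - d"
      then show "r (?q m) (?q (Suc m))" using p(3) ij by (cases "m = i") auto
    qed (use p ij in auto)
    then show False using k(2)[of "k - d"] \<open>d \<noteq> 0\<close> ij by auto
  qed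
  \<comment> \<open>A repetition is a shortcut to the successor of the later position; the last
    position has no successor and is covered by \<open>iB\<close>.\<close>
  have ne: "p i \<noteq> p j" if "i < j" "j \<le> k" for i j
  proof
    assume eq: "p i = p j"
    show False
    proof (cases "j = k")
      case True
      then show ?thesis using iB[of i] p(4) eq that by auto
    next
      case False
      then have "r (p i) (p (Suc j))" using p(3) that eq by auto
      then show False using shortcut[of i "j - i"] that False by auto
    qed
  qed
  have "induced_path r p k" unfolding induced_path_def
  proof (intro conjI allI impI)
    show "inj_on p {..k}" by (rule linorder_inj_onI) (use ne in auto)
    have adj: "j = Suc i" if "i < j" "j \<le> k" "r (p i) (p j)" for i j
    proof -
      have "i + (j - i - 1) < k" "Suc (i + (j - i - 1)) = j" using that by auto
      then have "j - i - 1 = 0" using shortcut[of i "j - i - 1"] that by simp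
      then show ?thesis using that by simp
    qed
    fix i j assume "i \<le> k" "j \<le> k"
    then show "r (p i) (p j) \<longleftrightarrow> j = Suc i \<or> i = Suc j"
      using adj[of i j] adj[of j i] p(3) sym[of "p i" "p j"] sym[of "p j" "p i"] irr
      by (cases i j rule: linorder_cases) (auto simp: Suc_le_eq)
  qed
  then show ?thesis using p(1,2,4) iA iB by blast
qed

lemma induced_cycleI:
  assumes "0 < n" "inj_on f {..<n}"
    and "\<And>i j. i < n \<Longrightarrow> j < n \<Longrightarrow> r (f i) (f j) \<longleftrightarrow> Suc i mod n = j \<or> Suc j mod n = i"
  shows "induced_cycle r (\<lambda>i. f (i mod n)) n"
  unfolding induced_cycle_def
proof (intro conjI allI)
  fix i j
  show "f (i mod n) = f (j mod n) \<longleftrightarrow> i mod n = j mod n"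
    using inj_on_eq_iff[OF assms(2), of "i mod n" "j mod n"] assms(1) by simp
  show "r (f (i mod n)) (f (j mod n)) \<longleftrightarrow> Suc i mod n = j mod n \<or> Suc j mod n = i mod n"
    using assms(3)[of "i mod n" "j mod n"] assms(1) by (simp add: mod_Suc_eq)
qed (rule assms(1))

lemma induced_cycle_shift:
  assumes "induced_cycle r g n"
  shows "induced_cycle r (\<lambda>i. g (i + k)) n"
proof -
  have *: "(a + k) mod n = (b + k) mod n \<longleftrightarrow> a mod n = b mod n" for a b :: nat
    by (simp add: nat_mod_eq_iff)
  show ?thesis unfolding induced_cycle_def
  proof (intro conjI allI)
    show "0 < n" using assms by (simp add: induced_cycle_def)
    fix i j
    show "g (i + k) = g (j + k) \<longleftrightarrow> i mod n = j mod n"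
      using assms by (simp add: induced_cycle_def *)
    have "r (g (i + k)) (g (j + k)) \<longleftrightarrow>
        (Suc i + k) mod n = (j + k) mod n \<or> (Suc j + k) mod n = (i + k) mod n"
      using assms by (simp add: induced_cycle_def)
    then show "r (g (i + k)) (g (j + k)) \<longleftrightarrow> Suc i mod n = j mod n \<or> Suc j mod n = i mod n"
      by (simp only: *)
  qed
qed

lemma induced_cycle_simps:
  assumes "induced_cycle r g n"
  shows "g i = g j \<longleftrightarrow> i mod n = j mod n"
    "r (g i) (g j) \<longleftrightarrow> Suc i mod n = j mod n \<or> Suc j mod n = i mod n"
  using assms unfolding induced_cycle_def by blast+

lemma induced_cycle_step:
  "induced_cycle r g n \<Longrightarrow> r (g i) (g (Suc i))"
  by (simp add: induced_cycle_def)

text \<open>Going around the cycle from \<open>k\<close> reaches every vertex: index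
  \<open>j + k * n\<close> names \<open>g j\<close> and is at least \<open>k\<close>.\<close>

lemma induced_cycle_induct2:
  assumes g: "induced_cycle r g n" and "P (g k)" "P (g (Suc k))"
    and step: "\<And>i. k \<le> i \<Longrightarrow> P (g i) \<Longrightarrow> P (g (Suc i)) \<Longrightarrow> P (g (Suc (Suc i)))"
  shows "P (g j)"
proof -
  have "P (g (k + m)) \<and> P (g (Suc (k + m)))" for m
    by (induction m) (use assms in auto)
  moreover have "j + k * n = k + (j + k * n - k)"
    using g by (simp add: induced_cycle_def Suc_le_eq trans_le_add2)
  ultimately have "P (g (j + k * n))" by metis
  moreover have "g (j + k * n) = g j" using g by (simp add: induced_cycle_def)
  ultimately show ?thesis by simp
qed

lemma induced_cycle_range:
  assumes "induced_cycle r g n"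
  shows "range g = g ` {..<n}" "finite (range g)" "card (range g) = n" "inj_on g {..<n}"
proof -
  have n: "0 < n" using assms by (simp add: induced_cycle_def)
  show r: "range g = g ` {..<n}"
  proof
    show "range g \<subseteq> g ` {..<n}"
    proof
      fix x assume "x \<in> range g"
      then obtain i where "x = g i" by auto
      then have "x = g (i mod n)" using induced_cycle_simps(1)[OF assms] by simp
      then show "x \<in> g ` {..<n}" using n by auto
    qed
  qed auto
  then show "finite (range g)" by simp
  show "inj_on g {..<n}" using induced_cycle_simps(1)[OF assms] by (auto simp: inj_on_def)
  then show "card (range g) = n" unfolding r by (simp add: card_image)
qed

lemma conn_induced_cycle:
  assumes g: "induced_cycle r g n"
  shows "conn r (range g)"
  unfolding conn_def
proof (intro allI impI, rule ccontr)
  fix A assume A: "A \<subseteq> range g" "A \<noteq> {} \<and> A \<noteq> range g" and no: "\<not> (\<exists>a\<in>A. \<exists>b\<in>range g - A. r a b)"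
  have step: "g (Suc i) \<in> A" if "g i \<in> A" for i
    using no that induced_cycle_step[OF g] by blast
  obtain k where "g k \<in> A" using A by auto
  then have "g j \<in> A" for j
    using induced_cycle_induct2[OF g, of "\<lambda>x. x \<in> A" k] step by blast
  then show False using A by auto
qed

text \<open>The \<open>k + 1\<close> path vertices and \<open>z\<close> make length
  \<open>k + 2\<close>, which is at least 4 for \<open>2 \<le> k\<close>.\<close>

lemma (in sgraph) induced_cycle_close_path:
  assumes p: "induced_path r p k" and k: "2 \<le> k"
    and z: "\<And>i. i \<le> k \<Longrightarrow> z \<noteq> p i" "\<And>i. i \<le> k \<Longrightarrow> r z (p i) \<longleftrightarrow> i = 0 \<or> i = k"
  obtains g where "induced_cycle r g (k + 2)" "range g \<subseteq> insert z (p ` {..k})"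
proof -
  define f where "f = p(Suc k := z)"
  have pinj: "inj_on p {..k}" and padj: "\<And>i j. i \<le> k \<Longrightarrow> j \<le> k \<Longrightarrow> r (p i) (p j) \<longleftrightarrow> j = Suc i \<or> i = Suc j"
    using p by (auto simp: induced_path_def)
  have "inj_on f {..<k + 2}"
  proof -
    have "{..<k + 2} = insert (Suc k) {..k}" by auto
    then show ?thesis using pinj z(1) by (auto simp: f_def inj_on_fun_updI inj_on_insert inj_on_def)
  qed
  moreover have "r (f i) (f j) \<longleftrightarrow> Suc i mod (k + 2) = j \<or> Suc j mod (k + 2) = i"
    if "i < k + 2" "j < k + 2" for i j
  proof -
    have m: "Suc i mod (k + 2) = (if i = Suc k then 0 else Suc i)" if "i < k + 2" for i
      using that by auto
    have "i = Suc k \<or> i \<le> k" "j = Suc k \<or> j \<le> k" using that by linarith+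
    then consider "i = Suc k" "j = Suc k" | "i = Suc k" "j \<le> k" | "i \<le> k" "j = Suc k" | "i \<le> k" "j \<le> k"
      by blast
    then show ?thesis
    proof cases
      case 3
      then have "r (p i) z \<longleftrightarrow> i = 0 \<or> i = k" using z(2)[of i] sym[of z "p i"] sym[of "p i" z] by auto
      then show ?thesis unfolding m[OF that(1)] m[OF that(2)] using 3 by (auto simp: f_def)
    qed (unfold m[OF that(1)] m[OF that(2)], use z(2)[of j] irr padj k in \<open>auto simp: f_def\<close>)
  qed
  ultimately have "induced_cycle r (\<lambda>i. f (i mod (k + 2))) (k + 2)" by (intro induced_cycleI) auto
  moreover have "f (i mod (k + 2)) \<in> insert z (p ` {..k})" for i
  proof -
    have "i mod (k + 2) < k + 2" by simp
    then consider "i mod (k + 2) = Suc k" | "i mod (k + 2) \<le> k" by linarith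
    then show ?thesis by cases (simp_all add: f_def)
  qed
  ultimately show ?thesis using that[of "\<lambda>i. f (i mod (k + 2))"] by blast
qed

lemma (in sgraph) induced_path_extend_both:
  assumes p: "induced_path r p k"
    and a: "\<And>i. i \<le> k \<Longrightarrow> a \<noteq> p i" "\<And>i. i \<le> k \<Longrightarrow> r a (p i) \<longleftrightarrow> i = 0"
    and b: "\<And>i. i \<le> k \<Longrightarrow> b \<noteq> p i" "\<And>i. i \<le> k \<Longrightarrow> r b (p i) \<longleftrightarrow> i = k"
    and ab: "a \<noteq> b" "\<not> r a b"
  defines "q \<equiv> \<lambda>i. if i = 0 then a else if i \<le> Suc k then p (i - 1) else b"
  shows "induced_path r q (k + 2)"
  unfolding induced_path_def
proof (intro conjI allI impI)
  have pinj: "p i = p j \<longleftrightarrow> i = j" if "i \<le> k" "j \<le> k" for i j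
    using p that by (auto simp: induced_path_def inj_on_def)
  have padj: "r (p i) (p j) \<longleftrightarrow> j = Suc i \<or> i = Suc j" if "i \<le> k" "j \<le> k" for i j
    using p that by (auto simp: induced_path_def)
  have pos: "i = 0 \<or> i = k + 2 \<or> (\<exists>m\<le>k. i = Suc m)" if "i \<le> k + 2" for i
    using that by (cases i) (auto simp: le_Suc_eq)
  have q: "q 0 = a" "q (k + 2) = b" "\<And>m. m \<le> k \<Longrightarrow> q (Suc m) = p m"
    by (auto simp: q_def)
  have symm: "r x y \<longleftrightarrow> r y x" for x y using sym[of x y] sym[of y x] by blast
  have ra: "r (p i) a \<longleftrightarrow> i = 0" and rb: "r (p i) b \<longleftrightarrow> i = k" if "i \<le> k" for i
    using a(2)[OF that] b(2)[OF that] symm[of "p i"] by simp_all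
  have rba: "\<not> r b a" using ab(2) symm[of b a] by simp
  have ne: "q i \<noteq> q j" if "i < j" "j \<le> k + 2" for i j
  proof -
    have "i = 0 \<or> (\<exists>m\<le>k. i = Suc m)" using pos[of i] that by auto
    moreover have "j = k + 2 \<or> (\<exists>m\<le>k. j = Suc m)" using pos[of j] that by auto
    ultimately consider "i = 0" "j = k + 2" | n where "i = 0" "j = Suc n" "n \<le> k"
      | m where "i = Suc m" "m \<le> k" "j = k + 2" | m n where "i = Suc m" "j = Suc n" "m \<le> k" "n \<le> k"
      by blast
    then show ?thesis
    proof cases
      case 1
      then show ?thesis using ab(1) q(1,2) by simp
    next
      case (2 n)
      then show ?thesis using a(1) q(1,3) by simp
    next
      case (3 m)
      then show ?thesis unfolding 3(1,3) q(2) q(3)[OF 3(2)] using b(1)[OF 3(2)] by simp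
    next
      case (4 m n)
      then show ?thesis using pinj[of m n] q(3) that by simp
    qed
  qed
  show "inj_on q {..k + 2}" by (rule linorder_inj_onI) (use ne in auto)
  fix i j assume "i \<le> k + 2" "j \<le> k + 2"
  from pos[OF this(1)] pos[OF this(2)]
  show "r (q i) (q j) \<longleftrightarrow> j = Suc i \<or> i = Suc j"
    by (elim disjE exE conjE; hypsubst; unfold q; auto simp: q(3) ab a(2) b(2) ra rb rba padj irr)
qed

lemma conn_insert:
  assumes "conn r X" "a \<in> X" "r a u" "r u a"
  shows "conn r (insert u X)"
  unfolding conn_def
proof (intro allI impI)
  fix A assume A: "A \<subseteq> insert u X" "A \<noteq> {} \<and> A \<noteq> insert u X"
  show "\<exists>x\<in>A. \<exists>y\<in>insert u X - A. r x y"
  proof (cases "A \<inter> X = {} \<or> X \<subseteq> A")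
    case True
    then consider "A = {u}" "u \<notin> X" | "u \<notin> A" "X \<subseteq> A" using A by blast
    then show ?thesis using assms by cases blast+
  next
    case False
    then have "A \<inter> X \<subseteq> X \<and> A \<inter> X \<noteq> {} \<and> A \<inter> X \<noteq> X" by blast
    then show ?thesis using assms(1) unfolding conn_def by blast
  qed
qed

lemma (in sgraph) ex_component:
  assumes "finite S" "z \<in> S"
  shows "\<exists>K\<subseteq>S. z \<in> K \<and> conn r K \<and> (\<forall>s\<in>S - K. \<forall>k\<in>K. \<not> r s k)"
proof -
  let ?P = "\<lambda>K. K \<subseteq> S \<and> z \<in> K \<and> conn r K"
  have "\<exists>K. ?P K \<and> (\<forall>L. ?P L \<longrightarrow> card L \<le> card K)"
    by (rule ex_has_greatest_nat[of _ "{z}" _ "Suc (card S)"])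
       (use assms conn_singleton card_mono in \<open>auto simp: less_Suc_eq_le\<close>)
  then obtain K where K: "?P K" "\<forall>L. ?P L \<longrightarrow> card L \<le> card K" by blast
  have "\<not> r s k" if "s \<in> S - K" "k \<in> K" for s k
  proof
    assume "r s k"
    then have "conn r (insert s K)" using conn_insert[of r K k s] K(1) that sym[of s k] by auto
    then have "card (insert s K) \<le> card K" using K(1) K(2)[rule_format, of "insert s K"] that by auto
    moreover have "finite K" using K(1) assms(1) finite_subset by auto
    ultimately show False using that by simp
  qed
  then show ?thesis using K by blast
qed

section \<open>Holes and antiholes with an anticomplete vertex\<close>

text \<open>Triangle \<open>a b c\<close>, pendants \<open>d\<close> at \<open>a\<close> and
  \<open>e\<close> at \<open>b\<close>. With the conclusion \<open>r d e\<close> it serves as a rule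
  for deriving edges; for a symmetric irreflexive \<open>r\<close> the pattern makes the five
  vertices distinct.\<close>

definition bull_free_on :: "('a \<Rightarrow> 'a \<Rightarrow> bool) \<Rightarrow> 'a set \<Rightarrow> bool" where
  "bull_free_on r V \<longleftrightarrow>
     (\<forall>a\<in>V. \<forall>b\<in>V. \<forall>c\<in>V. \<forall>d\<in>V. \<forall>e\<in>V. r a b \<longrightarrow> r a c \<longrightarrow> r b c \<longrightarrow> r a d \<longrightarrow> r b e \<longrightarrow>
       \<not> r b d \<longrightarrow> \<not> r c d \<longrightarrow> \<not> r a e \<longrightarrow> \<not> r c e \<longrightarrow> r d e)"

text \<open>Edges of an induced cycle join consecutive vertices, so the conclusion says that the
  neighbours of \<open>y\<close> on it are not stable.\<close>

definition odd_torch_free_on :: "('a \<Rightarrow> 'a \<Rightarrow> bool) \<Rightarrow> 'a set \<Rightarrow> bool" where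
  "odd_torch_free_on r V \<longleftrightarrow>
     (\<forall>g n x y. induced_cycle r g n \<longrightarrow> odd n \<longrightarrow> 5 \<le> n \<longrightarrow> range g \<subseteq> V \<longrightarrow> x \<in> V \<longrightarrow> y \<in> V \<longrightarrow>
       r x y \<longrightarrow> (\<forall>i. \<not> r x (g i)) \<longrightarrow> (\<exists>i. r y (g i)) \<longrightarrow> (\<exists>i. r y (g i) \<and> r y (g (Suc i))))"

text \<open>The last conjunct is the trace of bull-freeness on \<open>D\<close>: the triangle
  \<open>y a b\<close> with pendants \<open>x\<close> at \<open>y\<close> and \<open>c\<close> at
  \<open>a\<close> would be a bull if \<open>b\<close> and \<open>c\<close> were
  nonadjacent.\<close>

definition mixed_attachment :: "('a \<Rightarrow> 'a \<Rightarrow> bool) \<Rightarrow> 'a set \<Rightarrow> 'a \<Rightarrow> 'a \<Rightarrow> bool" where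
  "mixed_attachment r D x y \<longleftrightarrow>
     r x y \<and> (\<forall>d\<in>D. \<not> r x d) \<and> (\<exists>d\<in>D. r y d) \<and> (\<exists>d\<in>D. \<not> r y d) \<and>
     (\<forall>a\<in>D. \<forall>b\<in>D. \<forall>c\<in>D. r y a \<longrightarrow> r y b \<longrightarrow> \<not> r y c \<longrightarrow> r a b \<longrightarrow> r a c \<longrightarrow> r b c)"

lemma bull_free_onD:
  assumes "bull_free_on r V" "a \<in> V" "b \<in> V" "c \<in> V" "d \<in> V" "e \<in> V"
    "r a b" "r a c" "r b c" "r a d" "r b e" "\<not> r b d" "\<not> r c d" "\<not> r a e" "\<not> r c e"
  shows "r d e"
  by (rule assms(1)[unfolded bull_free_on_def, rule_format, OF assms(2-)])

lemma bull_free_on_subset: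
  assumes "bull_free_on r V" "S \<subseteq> V"
  shows "bull_free_on r S"
  unfolding bull_free_on_def
proof (intro ballI impI)
  fix a b c d e
  assume V: "a \<in> S" "b \<in> S" "c \<in> S" "d \<in> S" "e \<in> S"
    and *: "r a b" "r a c" "r b c" "r a d" "r b e" "\<not> r b d" "\<not> r c d" "\<not> r a e" "\<not> r c e"
  show "r d e"
    by (rule bull_free_onD[OF assms(1) _ _ _ _ _ *]) (use V assms(2) in auto)
qed

lemma induced_cycle_adj:
  assumes "induced_cycle r g n" "i < j" "j < n"
  shows "r (g i) (g j) \<longleftrightarrow> j = Suc i \<or> i = 0 \<and> Suc j = n" and "g i \<noteq> g j"
proof -
  have "Suc j mod n = (if Suc j = n then 0 else Suc j)" "Suc i mod n = Suc i"
    using assms by auto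
  then show "r (g i) (g j) \<longleftrightarrow> j = Suc i \<or> i = 0 \<and> Suc j = n"
    using induced_cycle_simps(2)[OF assms(1), of i j] assms by auto
  show "g i \<noteq> g j" using induced_cycle_simps(1)[OF assms(1), of i j] assms by simp
qed

lemma induced_cycle_neighbour:
  assumes "induced_cycle r g n" "r (g i) (g j)"
  shows "g j = g (Suc i) \<or> g j = g (i + (n - 1))"
proof -
  have n: "0 < n" using assms by (simp add: induced_cycle_def)
  have "j mod n = (i + (n - 1)) mod n" if "Suc j mod n = i mod n"
  proof -
    have "(Suc j + (n - 1)) mod n = (i + (n - 1)) mod n" using that by (rule mod_add_cong) simp
    moreover have "Suc j + (n - 1) = j + n" using n by simp
    ultimately show ?thesis by simp
  qed
  then show ?thesis
    using assms(2) induced_cycle_simps[OF assms(1)] by metis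
qed

context sgraph
begin

lemma rsym: "r x y \<longleftrightarrow> r y x"
  using sym[of x y] sym[of y x] by blast

text \<open>The bull is self-complementary: the complement has triangle \<open>d e c\<close> with
  pendants \<open>b\<close> at \<open>d\<close> and \<open>a\<close> at \<open>e\<close>.\<close>

lemma bull_free_on_co:
  assumes "bull_free_on r V"
  shows "bull_free_on (co r) V"
  unfolding bull_free_on_def
proof (intro ballI impI, rule ccontr)
  interpret c: sgraph "co r" by (rule sgraph_co)
  fix a b c d e
  assume V: "a \<in> V" "b \<in> V" "c \<in> V" "d \<in> V" "e \<in> V"
    and *: "co r a b" "co r a c" "co r b c" "co r a d" "co r b e" "\<not> co r b d" "\<not> co r c d"
      "\<not> co r a e" "\<not> co r c e" "\<not> co r d e"
  have ne: "b \<noteq> d" "c \<noteq> d" "a \<noteq> e" "c \<noteq> e" "d \<noteq> e" using * c.rsym by metis+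
  have "r b a"
  proof (rule bull_free_onD[OF assms V(4) V(5) V(3) V(2) V(1)])
    show "r d e" "r d c" "r e c" "r d b" "r e a" using * ne rsym by (auto simp: co_def)
    show "\<not> r e b" "\<not> r c b" "\<not> r d a" "\<not> r c a" using * rsym by (auto simp: co_def)
  qed
  then show False using *(1) rsym[of a b] by (auto simp: co_def)
qed

lemma prime_mixed:
  assumes "prime_on r V" "X \<subseteq> V" "2 \<le> card X" "X \<noteq> V"
  shows "\<exists>u\<in>V - X. \<exists>a\<in>X. \<exists>b\<in>X. r u a \<and> \<not> r u b"
proof -
  have "\<not> homogeneous r V X" using assms unfolding prime_on_def by blast
  then show ?thesis using assms(2) by (auto simp: homogeneous_def)
qed

lemma conn_mixed_edge:
  assumes "conn r X" "a \<in> X" "b \<in> X" "r u a" "\<not> r u b"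
  shows "\<exists>x\<in>X. \<exists>y\<in>X. r u x \<and> \<not> r u y \<and> r x y"
  using conn_boundary_edge[of r X a b "r u"] assms by simp

text \<open>Let \<open>Z\<close> be the set of vertices anticomplete to \<open>D\<close>. If all neighbours of \<open>Z\<close> outside
  \<open>Z\<close> were complete to \<open>D\<close>, then a maximal connected set \<open>Q \<supseteq> D\<close> that is anticomplete to \<open>Z\<close>
  and complete to these neighbours would be homogeneous.\<close>

lemma ex_mixed_attachment:
  assumes pr: "prime_on r V" and bf: "bull_free_on r V"
    and D: "D \<subseteq> V" "conn r D" "2 \<le> card D" and v: "v \<in> V - D" "\<forall>d\<in>D. \<not> r v d"
  shows "\<exists>x\<in>V. \<exists>y\<in>V. mixed_attachment r D x y"
proof -
  have finV: "finite V" using pr by (simp add: prime_on_def)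
  define Z where "Z = {z\<in>V - D. \<forall>d\<in>D. \<not> r z d}"
  define Y where "Y = {y\<in>V - Z. \<exists>z\<in>Z. r y z}"
  have "\<exists>y\<in>Y. \<exists>d\<in>D. \<not> r y d"
  proof (rule ccontr)
    assume "\<not> ?thesis"
    then have YD: "\<forall>y\<in>Y. \<forall>d\<in>D. r y d" by blast
    let ?P = "\<lambda>Q. D \<subseteq> Q \<and> Q \<subseteq> V \<and> conn r Q \<and> (\<forall>q\<in>Q. q \<notin> Z \<and> (\<forall>z\<in>Z. \<not> r q z)) \<and> (\<forall>y\<in>Y. \<forall>q\<in>Q. r y q)"
    have "?P D" using D YD rsym by (auto simp: Z_def)
    moreover have "\<forall>L. ?P L \<longrightarrow> card L < Suc (card V)"
      using card_mono[OF finV] by (simp add: less_Suc_eq_le)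
    ultimately have "\<exists>Q. ?P Q \<and> (\<forall>L. ?P L \<longrightarrow> card L \<le> card Q)"
      by (rule ex_has_greatest_nat[of ?P])
    then obtain Q where Q: "D \<subseteq> Q" "Q \<subseteq> V" "conn r Q" "\<forall>q\<in>Q. q \<notin> Z \<and> (\<forall>z\<in>Z. \<not> r q z)"
      "\<forall>y\<in>Y. \<forall>q\<in>Q. r y q" and max: "\<forall>L. ?P L \<longrightarrow> card L \<le> card Q" by blast
    have finQ: "finite Q" using Q(2) finV finite_subset by auto
    have "v \<in> Z" using v by (simp add: Z_def)
    then have "Q \<noteq> V" using Q(4) v by auto
    moreover have "2 \<le> card Q" using D(3) card_mono[OF finQ Q(1)] by simp
    ultimately obtain u a0 b0 where u: "u \<in> V - Q" "a0 \<in> Q" "b0 \<in> Q" "r u a0" "\<not> r u b0"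
      using prime_mixed[OF pr Q(2)] by blast
    obtain a b where ab: "a \<in> Q" "b \<in> Q" "r u a" "\<not> r u b" "r a b"
      using conn_mixed_edge[OF Q(3) u(2-5)] by blast
    have uZ: "u \<notin> Z" using Q(4) ab(1,3) rsym[of u a] by auto
    have "u \<notin> Y" using Q(5) ab(2,4) by auto
    then have uz: "\<not> r u z" if "z \<in> Z" for z using that uZ u(1) by (auto simp: Y_def)
    \<comment> \<open>Otherwise the triangle \<open>y a b\<close> with pendants \<open>z\<close> at
      \<open>y\<close> and \<open>u\<close> at \<open>a\<close> is a bull. Hence \<open>u\<close>
      can be added to \<open>Q\<close>.\<close>
    have yu: "r y u" if y: "y \<in> Y" for y
    proof (rule ccontr)
      assume n: "\<not> r y u"
      obtain z where z: "z \<in> Z" "r y z" using y by (auto simp: Y_def)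
      have V: "y \<in> V" "a \<in> V" "b \<in> V" "z \<in> V" "u \<in> V"
        using y z ab u Q(2) by (auto simp: Y_def Z_def)
      have "r z u"
        by (rule bull_free_onD[OF bf V])
           (use n z ab y Q(4,5) rsym[of u a] rsym[of u b] in auto)
      then show False using uz z rsym[of u z] by auto
    qed
    have "conn r (insert u Q)" using conn_insert[OF Q(3) ab(1)] ab(3) rsym[of u a] by blast
    then have "?P (insert u Q)" using Q u(1) uZ uz yu by auto
    then have "card (insert u Q) \<le> card Q" using max by blast
    then show False using u(1) finQ by simp
  qed
  then obtain y where y: "y \<in> Y" "\<exists>d\<in>D. \<not> r y d" by blast
  then obtain x where x: "x \<in> Z" "r y x" by (auto simp: Y_def)
  have xV: "x \<in> V" "\<forall>d\<in>D. \<not> r x d" using x by (auto simp: Z_def)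
  have "y \<notin> D" using x xV rsym[of x y] by auto
  then have yV: "y \<in> V" "\<exists>d\<in>D. r y d" using y by (auto simp: Y_def Z_def)
  have "r b c" if abc: "a \<in> D" "b \<in> D" "c \<in> D" "r y a" "r y b" "\<not> r y c" "r a b" "r a c" for a b c
  proof (rule ccontr)
    assume "\<not> r b c"
    have V: "a \<in> V" "b \<in> V" "c \<in> V" using abc D by auto
    have "r x c"
      by (rule bull_free_onD[OF bf yV(1) V(1,2) xV(1) V(3)])
         (use \<open>\<not> r b c\<close> abc x xV rsym[of x] in auto)
    then show False using xV abc by auto
  qed
  then have "\<forall>a\<in>D. \<forall>b\<in>D. \<forall>c\<in>D. r y a \<longrightarrow> r y b \<longrightarrow> \<not> r y c \<longrightarrow> r a b \<longrightarrow> r a c \<longrightarrow> r b c"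
    by simp
  then show ?thesis using xV yV y(2) sym[OF x(2)] unfolding mixed_attachment_def by blast
qed

text \<open>Torch-freeness gives the attachment \<open>y\<close> two consecutive neighbours.
  Vertices two apart on the hole are nonadjacent, so the bull condition forces the next vertex as
  well, until \<open>y\<close> is complete to the hole and no longer mixed.\<close>

lemma no_odd_hole_with_anticomplete_vertex:
  assumes pr: "prime_on r V" and bf: "bull_free_on r V" and tf: "odd_torch_free_on r V"
    and g: "induced_cycle r g n" "odd n" "5 \<le> n" "range g \<subseteq> V"
    and v: "v \<in> V" "v \<notin> range g" "\<And>i. \<not> r v (g i)"
  shows False
proof -
  have c: "2 \<le> card (range g)" using induced_cycle_range(3)[OF g(1)] g(3) by simp
  have v': "v \<in> V - range g" "\<forall>d\<in>range g. \<not> r v d" using v by auto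
  obtain x y where xyV: "x \<in> V" "y \<in> V" and "mixed_attachment r (range g) x y"
    using ex_mixed_attachment[OF pr bf g(4) conn_induced_cycle[OF g(1)] c v'] by (elim bexE)
  then have xy: "r x y" "\<forall>d\<in>range g. \<not> r x d" "\<exists>d\<in>range g. r y d" "\<exists>d\<in>range g. \<not> r y d"
    and "\<forall>a\<in>range g. \<forall>b\<in>range g. \<forall>c\<in>range g. r y a \<longrightarrow> r y b \<longrightarrow> \<not> r y c \<longrightarrow> r a b \<longrightarrow> r a c
      \<longrightarrow> r b c"
    unfolding mixed_attachment_def by blast+
  then have tri: "r b c" if "a \<in> range g" "b \<in> range g" "c \<in> range g" "r y a" "r y b" "\<not> r y c"
      "r a b" "r a c" for a b c
    using that by blast
  obtain k where k: "r y (g k)" "r y (g (Suc k))"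
    using tf[unfolded odd_torch_free_on_def, rule_format, OF g xyV xy(1)] xy(2,3) by auto
  have "r y (g (Suc (Suc i)))" if "r y (g i)" "r y (g (Suc i))" for i
  proof (rule ccontr)
    assume "\<not> r y (g (Suc (Suc i)))"
    then have "r (g i) (g (Suc (Suc i)))"
      using tri[of "g (Suc i)" "g i" "g (Suc (Suc i))"] that induced_cycle_step[OF g(1)]
        rsym[of "g i" "g (Suc i)"] by auto
    moreover have "induced_cycle r (\<lambda>j. g (j + i)) n" by (rule induced_cycle_shift[OF g(1)])
    ultimately show False using induced_cycle_adj(1)[of r "\<lambda>j. g (j + i)" n 0 2] g(3) by simp
  qed
  then have "r y (g j)" for j
    using induced_cycle_induct2[OF g(1), of "r y" k] k by blast
  then show False using xy(4) by auto
qed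

lemma no_antihole_with_anticomplete_vertex:
  assumes pr: "prime_on r V" and bf: "bull_free_on r V"
    and g: "induced_cycle (co r) g n" "6 \<le> n" "range g \<subseteq> V"
    and v: "v \<in> V" "v \<notin> range g" "\<And>i. \<not> r v (g i)"
  shows False
proof -
  have card: "card (range g) = n" by (rule induced_cycle_range(3)[OF g(1)])
  have fin: "finite (range g)" by (rule induced_cycle_range(2)[OF g(1)])
  have two: "card B \<le> 2" if B: "B \<subseteq> range g" "\<And>b. b \<in> B \<Longrightarrow> co r (g i) b" for B i
  proof -
    have "B \<subseteq> {g (Suc i), g (i + (n - 1))}"
      using B induced_cycle_neighbour[OF g(1), of i] by blast
    then have "card B \<le> card {g (Suc i), g (i + (n - 1))}" by (intro card_mono) auto
    also have "\<dots> \<le> 2" by (simp add: card_insert_if)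
    finally show ?thesis .
  qed
  \<comment> \<open>Across a cut without edges every vertex is consecutive to the whole other side,
    so each side has at most 2 of the \<open>n \<ge> 6\<close> vertices.\<close>
  have "conn r (range g)" unfolding conn_def
  proof (intro allI impI, rule ccontr)
    fix A assume A: "A \<subseteq> range g" "A \<noteq> {} \<and> A \<noteq> range g" and no: "\<not> (\<exists>a\<in>A. \<exists>b\<in>range g - A. r a b)"
    obtain i where i: "g i \<in> A" using A by blast
    obtain j where j: "g j \<in> range g - A" using A by blast
    have "card (range g - A) \<le> 2"
      by (rule two[of _ i]) (use i no in \<open>auto simp: co_def\<close>)
    moreover have "card A \<le> 2"
    proof (rule two[of _ j])
      fix b assume "b \<in> A"
      then show "co r (g j) b" using j no rsym[of b "g j"] by (auto simp: co_def)
    qed (rule A)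
    moreover have "card (range g) = card A + card (range g - A)"
      using card_Int_Diff[OF fin, of A] A(1) by (simp add: Int_absorb1)
    ultimately show False using card g(2) by simp
  qed
  moreover have "2 \<le> card (range g)" using card g(2) by simp
  moreover have "v \<in> V - range g" "\<forall>d\<in>range g. \<not> r v d" using v by auto
  ultimately have "\<exists>x\<in>V. \<exists>y\<in>V. mixed_attachment r (range g) x y"
    by (rule ex_mixed_attachment[OF pr bf g(3)])
  then obtain x y where xyV: "x \<in> V" "y \<in> V" and "mixed_attachment r (range g) x y"
    by (elim bexE)
  then have xy: "r x y" "\<forall>d\<in>range g. \<not> r x d" "\<exists>d\<in>range g. r y d" "\<exists>d\<in>range g. \<not> r y d"
    and "\<forall>a\<in>range g. \<forall>b\<in>range g. \<forall>c\<in>range g. r y a \<longrightarrow> r y b \<longrightarrow> \<not> r y c \<longrightarrow> r a b \<longrightarrow> r a c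
      \<longrightarrow> r b c"
    unfolding mixed_attachment_def by blast+
  then have tri: "r b c" if "a \<in> range g" "b \<in> range g" "c \<in> range g" "r y a" "r y b" "\<not> r y c"
      "r a b" "r a c" for a b c
    using that by blast
  have "\<exists>k. \<not> r y (g k) \<and> r y (g (Suc k))"
  proof (rule ccontr)
    assume no: "\<not> ?thesis"
    obtain k where "\<not> r y (g k)" using xy(4) by auto
    then have "\<not> r y (g j)" for j
      using induced_cycle_induct2[OF g(1), of "\<lambda>x. \<not> r y x" k] no by blast
    then show False using xy(3) by auto
  qed
  then obtain k where k: "\<not> r y (g k)" "r y (g (Suc k))" by blast
  define h where "h = (\<lambda>i. g (i + k))"
  have h: "induced_cycle (co r) h n" unfolding h_def by (rule induced_cycle_shift[OF g(1)])
  have hV: "h i \<in> range g" "h i \<in> V" for i using g(3) by (auto simp: h_def)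
  have adj: "r (h i) (h j) \<longleftrightarrow> j \<noteq> Suc i \<and> \<not> (i = 0 \<and> Suc j = n)" if "i < j" "j < n" for i j
    using induced_cycle_adj[OF h that] by (auto simp: co_def)
  have y01: "\<not> r y (h 0)" "r y (h 1)" using k by (auto simp: h_def)
  \<comment> \<open>Such an \<open>h j\<close> is adjacent to both \<open>h 0\<close> and
    \<open>h 1\<close>, so the bull condition would join these two.\<close>
  have far: "\<not> r y (h j)" if "3 \<le> j" "j \<le> n - 2" for j
  proof
    assume "r y (h j)"
    then have "r (h 1) (h 0)"
      using tri[of "h j" "h 1" "h 0"] y01 hV adj[of 1 j] adj[of 0 j] rsym[of "h j"] that g(2) by auto
    then show False using adj[of 0 1] g(2) rsym[of "h 1" "h 0"] by auto
  qed
  have last: "\<not> r y (h (n - 1))"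
  proof
    assume "r y (h (n - 1))"
    then have "r (h (n - 1)) (h (n - 2))"
      using tri[of "h 1" "h (n - 1)" "h (n - 2)"] y01 hV far[of "n - 2"] adj[of 1 "n - 1"]
        adj[of 1 "n - 2"] g(2) by auto
    then show False using adj[of "n - 2" "n - 1"] g(2) rsym[of "h (n - 1)" "h (n - 2)"] by auto
  qed
  \<comment> \<open>Triangle \<open>h 1\<close>, \<open>h 3\<close>, \<open>h (n - 1)\<close> with
    pendants \<open>y\<close> at \<open>h 1\<close> and \<open>h 0\<close> at \<open>h 3\<close>;
    whether \<open>y\<close> sees \<open>h 2\<close> is left open.\<close>
  have "r y (h 0)"
    by (rule bull_free_onD[OF bf hV(2)[of 1] hV(2)[of 3] hV(2)[of "n - 1"] xyV(2) hV(2)[of 0]])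
       (use adj[of 1 3] adj[of 1 "n - 1"] adj[of 3 "n - 1"] adj[of 0 1] adj[of 0 3] adj[of 0 "n - 1"]
          y01 far[of 3] last g(2) rsym[of y] rsym[of _ "h 0"] in auto)
  then show False using y01 by simp
qed

end

section \<open>Minimal imperfect bull-free graphs\<close>

abbreviation nbrs :: "('a \<Rightarrow> 'a \<Rightarrow> bool) \<Rightarrow> 'a set \<Rightarrow> 'a \<Rightarrow> 'a set" where
  "nbrs r V v \<equiv> {x\<in>V. r v x}"

context sgraph
begin

text \<open>Both sides of an edgeless cut are homogeneous, hence single vertices by primality; an
  isolated vertex is dominated by the other one.\<close>

lemma conn_min_imperfect:
  assumes mi: "min_imperfect r V"
  shows "conn r V"
  unfolding conn_def
proof (intro allI impI, rule ccontr)
  fix A assume A: "A \<subseteq> V" "A \<noteq> {} \<and> A \<noteq> V" and no: "\<not> (\<exists>a\<in>A. \<exists>b\<in>V - A. r a b)"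
  have pr: "prime_on r V" by (rule min_imperfect_prime[OF mi])
  have fin: "finite V" using mi by (simp add: min_imperfect_def)
  have sep: "\<not> r a b" "\<not> r b a" if "a \<in> A" "b \<in> V - A" for a b
    using no that rsym[of a b] by blast+
  have "homogeneous r V A" using A(1) sep unfolding homogeneous_def by blast
  then have cA: "\<not> 2 \<le> card A" using pr A by (auto simp: prime_on_def)
  have "homogeneous r V (V - A)" using A(1) sep unfolding homogeneous_def by blast
  moreover have "V - A \<noteq> V" using A by blast
  ultimately have cB: "\<not> 2 \<le> card (V - A)" using pr by (auto simp: prime_on_def)
  obtain a where a: "a \<in> A" using A by blast
  obtain b where b: "b \<in> V - A" using A by blast
  have "card A = 1" using cA a finite_subset[OF A(1) fin] card_gt_0_iff[of A] by force
  then have "A = {a}" using a card_1_singletonE by blast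
  have nx: "\<not> r a x" if "x \<in> V" for x
  proof (cases "x = a")
    case False
    then show ?thesis using sep(1)[OF a] that \<open>A = {a}\<close> by simp
  qed (simp add: irr)
  show False
    by (rule min_imperfect_no_domination[OF mi, of a b]) (use a b A(1) nx in auto)
qed

lemma min_imperfect_nonsingleton:
  assumes mi: "min_imperfect r V"
  shows "V \<noteq> {v}"
proof
  assume V: "V = {v}"
  obtain w where w: "critical r V w" using min_imperfect_critical[OF mi] .
  then have "card {v} \<le> w" unfolding critical_def V by (auto simp: clique_def)
  then have "colourable_on r V w"
    unfolding colourable_on_def V by (intro exI[of _ "\<lambda>_. 0"]) (auto simp: irr)
  then show False using w by (simp add: critical_def)
qed

lemma min_imperfect_nbrs_nonempty:
  assumes mi: "min_imperfect r V" and v: "v \<in> V"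
  shows "nbrs r V v \<noteq> {}"
proof -
  have "{v} \<subseteq> V" "{v} \<noteq> {} \<and> {v} \<noteq> V" using min_imperfect_nonsingleton[OF mi, of v] v by auto
  then have "\<exists>a\<in>{v}. \<exists>b\<in>V - {v}. r a b"
    using conn_min_imperfect[OF mi] unfolding conn_def by blast
  then show ?thesis by blast
qed

lemma min_imperfect_nonnbrs_nonempty:
  assumes "min_imperfect r V" "v \<in> V"
  shows "nbrs (co r) V v \<noteq> {}"
  by (rule sgraph.min_imperfect_nbrs_nonempty[OF sgraph_co min_imperfect_co[OF assms(1)] assms(2)])

text \<open>Otherwise \<open>v\<close> together with its neighbours is a star cutset.\<close>

lemma conn_nonnbrs:
  assumes mi: "min_imperfect r V" and v: "v \<in> V"
  shows "conn r (nbrs (co r) V v)"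
  unfolding conn_def
proof (intro allI impI, rule ccontr)
  let ?M = "nbrs (co r) V v"
  fix A assume A: "A \<subseteq> ?M" "A \<noteq> {} \<and> A \<noteq> ?M" and no: "\<not> (\<exists>a\<in>A. \<exists>b\<in>?M - A. r a b)"
  show False
    by (rule min_imperfect_no_star_cutset[OF mi, of A "?M - A" "V - ?M" v])
       (use A no v in \<open>auto simp: co_def\<close>)
qed

lemma conn_co_nbrs:
  assumes "min_imperfect r V" "v \<in> V"
  shows "conn (co r) (nbrs r V v)"
  using sgraph.conn_nonnbrs[OF sgraph_co min_imperfect_co[OF assms(1)] assms(2)] unfolding co_co .

lemma conn_delete_vertex:
  assumes mi: "min_imperfect r V" and v: "v \<in> V"
  shows "conn r (V - {v})"
  unfolding conn_def
proof (intro allI impI, rule ccontr)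
  fix A assume A: "A \<subseteq> V - {v}" "A \<noteq> {} \<and> A \<noteq> V - {v}" and no: "\<not> (\<exists>a\<in>A. \<exists>b\<in>V - {v} - A. r a b)"
  show False
    by (rule min_imperfect_no_star_cutset[OF mi, of A "V - {v} - A" "{v}" v]) (use A no v in auto)
qed

text \<open>Otherwise \<open>v\<close> and its neighbours other than \<open>n\<close> form a star
  cutset that separates \<open>n\<close> from the nonneighbours of \<open>v\<close>.\<close>

lemma nbr_has_nonnbr_nbr:
  assumes mi: "min_imperfect r V" and v: "v \<in> V" and n: "n \<in> nbrs r V v"
  shows "\<exists>m\<in>nbrs (co r) V v. r n m"
proof (rule ccontr)
  let ?M = "nbrs (co r) V v"
  assume no: "\<not> ?thesis"
  show False
    by (rule min_imperfect_no_star_cutset[OF mi, of "{n}" ?M "V - {n} - ?M" v])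
       (use no v n irr min_imperfect_nonnbrs_nonempty[OF mi v] in \<open>auto simp: co_def\<close>)
qed

text \<open>The prism is the complement of the 6-cycle \<open>a w' p w a' p'\<close>: triangles
  \<open>a p a'\<close> and \<open>w w' p'\<close>, rungs \<open>a w\<close>, \<open>a' w'\<close>,
  \<open>p p'\<close>.\<close>

lemma no_prism:
  assumes "\<And>g n. induced_cycle (co r) g n \<Longrightarrow> 6 \<le> n \<Longrightarrow> range g \<subseteq> V \<Longrightarrow> False"
    and V: "{a, w', p, w, a', p'} \<subseteq> V"
    and co: "co r a w'" "co r w' p" "co r p w" "co r w a'" "co r a' p'" "co r p' a"
    and adj: "r a p" "r a w" "r a a'" "r w' w" "r w' a'" "r w' p'" "r p a'" "r p p'" "r w p'"
  shows False
proof -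
  interpret c: sgraph "co r" by (rule sgraph_co)
  define f where "f = (\<lambda>i. [a, w', p, w, a', p'] ! i)"
  have f: "f 0 = a" "f 1 = w'" "f 2 = p" "f 3 = w" "f 4 = a'" "f 5 = p'"
    by (simp_all add: f_def)
  note adj' = adj adj[THEN sym]
  note co' = co co[THEN c.sym]
  have nc: "\<not> co r a p" "\<not> co r a w" "\<not> co r a a'" "\<not> co r w' w" "\<not> co r w' a'" "\<not> co r w' p'"
    "\<not> co r p a'" "\<not> co r p p'" "\<not> co r w p'"
    "\<not> co r p a" "\<not> co r w a" "\<not> co r a' a" "\<not> co r w w'" "\<not> co r a' w'" "\<not> co r p' w'"
    "\<not> co r a' p" "\<not> co r p' p" "\<not> co r p' w"
    by (simp_all add: co_def adj')
  have six: "i = 0 \<or> i = 1 \<or> i = 2 \<or> i = 3 \<or> i = 4 \<or> i = 5" if "i < 6" for i :: nat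
    using that by linarith
  have 1: "f i \<noteq> f j" if "i < j" "j < 6" for i j
  proof -
    have ne: "a \<noteq> w'" "w' \<noteq> p" "p \<noteq> w" "w \<noteq> a'" "a' \<noteq> p'" "a \<noteq> p'"
      "a \<noteq> p" "a \<noteq> w" "a \<noteq> a'" "w' \<noteq> w" "w' \<noteq> a'" "w' \<noteq> p'" "p \<noteq> a'" "p \<noteq> p'" "w \<noteq> p'"
      using co adj irr by (auto simp: co_def)
    have i: "i < 6" using that by simp
    show ?thesis using six[OF i] six[OF that(2)] that(1)
      by (elim disjE; hypsubst; unfold f; simp add: ne)
  qed
  have 2: "co r (f i) (f j) \<longleftrightarrow> Suc i mod 6 = j \<or> Suc j mod 6 = i" if "i < 6" "j < 6" for i j
    using six[OF that(1)] six[OF that(2)]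
    by (elim disjE; hypsubst; unfold f; simp add: co' nc c.irr)
  have "inj_on f {..<6}" by (rule linorder_inj_onI) (use 1 in auto)
  then have "induced_cycle (co r) (\<lambda>i. f (i mod 6)) 6"
    by (intro induced_cycleI) (use 2 in auto)
  moreover have "f (i mod 6) \<in> V" for i
  proof -
    have "i mod 6 < 6" by simp
    from six[OF this] show ?thesis using V by (elim disjE; simp only: f; simp)
  qed
  ultimately show False using assms(1)[of _ 6] by blast
qed

end

text \<open>The situation of a minimal imperfect subgraph among the nonneighbours of a vertex of a
  prime graph. Even holes of length at least 6 are still possible here.\<close>

locale min_imperfect_bull_free = sgraph +
  fixes V :: "'a set"
  assumes mi: "min_imperfect r V" and bf: "bull_free_on r V"
    and no_antihole: "induced_cycle (co r) g n \<Longrightarrow> 6 \<le> n \<Longrightarrow> range g \<subseteq> V \<Longrightarrow> False"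
    and no_odd_hole: "induced_cycle r g n \<Longrightarrow> 5 \<le> n \<Longrightarrow> odd n \<Longrightarrow> range g \<subseteq> V \<Longrightarrow> False"
begin

section \<open>Neighbourhoods and long holes\<close>

lemma finV: "finite V"
  using mi by (simp add: min_imperfect_def)

text \<open>Suppose that all vertices \<open>w\<close> mixed on \<open>X\<close> are nonadjacent to \<open>p\<close>. Then the
  neighbourhoods of adjacent vertices of \<open>X\<close> among these \<open>w\<close> are nested, since otherwise there
  is a prism or a bull. So for \<open>a\<close> in \<open>X\<close> with a minimal neighbourhood, the neighbours of \<open>a\<close>
  in \<open>X\<close> are complete to all other neighbours of \<open>a\<close>.\<close>

lemma ex_mixed_adjacent:
  assumes X: "X \<subseteq> V" "conn r X" "2 \<le> card X"
    and p: "p \<in> V" "\<forall>x\<in>X. r p x"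
    and q: "q \<in> V" "q \<notin> X" "\<forall>x\<in>X. \<not> r q x" "r p q"
  shows "\<exists>w\<in>V - X. r w p \<and> (\<exists>a\<in>X. \<exists>b\<in>X. r w a \<and> \<not> r w b)"
proof (rule ccontr)
  assume no: "\<not> ?thesis"
  have finX: "finite X" using X(1) finV finite_subset by auto
  have pX: "p \<notin> X" using p irr by auto
  have wp: "\<not> r w p" if "w \<in> V - X" "a \<in> X" "b \<in> X" "r w a" "\<not> r w b" for w a b
    using no that by blast
  \<comment> \<open>Triangle \<open>a p b\<close> with pendants \<open>w\<close> at \<open>a\<close>
    and \<open>q\<close> at \<open>p\<close>.\<close>
  have wq: "r w q" if w: "w \<in> V - X" "a \<in> X" "b \<in> X" "r w a" "\<not> r w b" "r a b" for w a b
    by (rule bull_free_onD[OF bf, of a p b w q])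
       (use w wp[OF w(1-5)] X(1) p q in \<open>auto simp: rsym\<close>)
  define F where "F = (\<lambda>a. {w\<in>V - X. r w a \<and> (\<exists>b\<in>X. \<not> r w b)})"
  have nested: "F a \<subseteq> F b \<or> F b \<subseteq> F a" if ab: "a \<in> X" "b \<in> X" "r a b" for a b
  proof (rule ccontr)
    assume "\<not> ?thesis"
    then obtain w u where w: "w \<in> V - X" "r w a" "\<not> r w b" and u: "u \<in> V - X" "r u b" "\<not> r u a"
      using ab by (auto simp: F_def)
    have ba: "r b a" by (rule sym[OF ab(3)])
    have wpq: "\<not> r w p" "r w q" using wp[OF w(1) ab(1,2) w(2,3)] wq[OF w(1) ab(1,2) w(2,3) ab(3)] .
    have upq: "\<not> r u p" "r u q" using wp[OF u(1) ab(2,1) u(2,3)] wq[OF u(1) ab(2,1) u(2,3) ba] .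
    have wu: "r w u"
      by (rule bull_free_onD[OF bf, of a b p w u])
         (use w u wpq upq ab ba p X(1) in \<open>auto simp: rsym\<close>)
    have ne: "a \<noteq> u" "u \<noteq> p" "p \<noteq> w" "w \<noteq> b" "b \<noteq> q" "q \<noteq> a"
      using ab u w pX q p upq wpq by auto
    \<comment> \<open>Prism with triangles \<open>a b p\<close> and \<open>w u q\<close>, rungs
      \<open>a w\<close>, \<open>b u\<close>, \<open>p q\<close>.\<close>
    show False
      by (rule no_prism[of V a u p w b q, OF no_antihole])
         (use ab ba w u wu wpq upq p q ne X(1) in
           \<open>auto simp: rsym co_def\<close>)
  qed
  have "\<exists>a. a \<in> X \<and> (\<forall>b. b \<in> X \<longrightarrow> card (F a) \<le> card (F b))"
  proof -
    have "X \<noteq> {}" using X(3) by auto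
    then obtain x where "x \<in> X" by blast
    then show ?thesis by (rule ex_has_least_nat)
  qed
  then obtain a where a: "a \<in> X" "\<forall>b\<in>X. card (F a) \<le> card (F b)" by blast
  have finF: "finite (F b)" for b using finV by (simp add: F_def)
  let ?B = "{x\<in>X. r a x}"
  have "X \<noteq> {a}" using X(3) by auto
  then have "\<exists>x\<in>{a}. \<exists>y\<in>X - {a}. r x y"
    using X(2)[unfolded conn_def, rule_format, of "{a}"] a(1) by auto
  then have B0: "?B \<noteq> {}" by auto
  have "r a p" using p a sym by auto
  then have "p \<in> nbrs r V a - ?B" using p(1) pX by auto
  then have B1: "?B \<noteq> {} \<and> ?B \<noteq> nbrs r V a" using B0 by blast
  have aV: "a \<in> V" using a X by auto
  have "\<exists>b\<in>?B. \<exists>y\<in>nbrs r V a - ?B. co r b y"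
    using conn_co_nbrs[OF mi aV, unfolded conn_def, rule_format, OF _ B1] X(1) by blast
  then obtain b y where b: "b \<in> X" "r a b" and y: "y \<in> V - X" "r a y" "co r b y" by blast
  have yb: "\<not> r y b" using y(3) rsym[of y b] by (simp add: co_def)
  have "y \<in> F a" using y b(1) yb by (auto simp: F_def rsym)
  \<comment> \<open>If instead \<open>F b \<subseteq> F a\<close>, minimality of
    \<open>card (F a)\<close> makes them equal.\<close>
  moreover have "F a \<subseteq> F b"
    using nested[OF a(1) b] a(2) b(1) card_seteq[OF finF, of "F b" a] by blast
  ultimately show False using yb by (auto simp: F_def)
qed

text \<open>Let \<open>K\<close> be the component of the edge \<open>a b\<close> in the
  neighbourhood, and \<open>q\<close> a neighbour of \<open>v\<close> outside.
  \<open>ex_mixed_adjacent\<close> yields a vertex outside \<open>K\<close> that is adjacent to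
  \<open>v\<close> and to part of \<open>K\<close>, so \<open>K\<close> was no component.\<close>

lemma conn_nbrs:
  assumes v: "v \<in> V" and ab: "a \<in> nbrs r V v" "b \<in> nbrs r V v" "r a b"
  shows "conn r (nbrs r V v)"
proof (rule ccontr)
  assume nc: "\<not> conn r (nbrs r V v)"
  have fin: "finite (nbrs r V v)" using finV by simp
  obtain K where K: "K \<subseteq> nbrs r V v" "a \<in> K" "conn r K" "\<forall>s\<in>nbrs r V v - K. \<forall>k\<in>K. \<not> r s k"
    using ex_component[OF fin ab(1)] by blast
  have finK: "finite K" using K(1) fin finite_subset by auto
  have "b \<in> K" using K(2,4) ab(2) sym[OF ab(3)] by blast
  moreover have "a \<noteq> b" using ab irr by auto
  ultimately have cK: "2 \<le> card K"
    using card_mono[OF finK, of "{a, b}"] K(2) by auto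
  have "K \<noteq> nbrs r V v" using nc K(3) by metis
  then obtain q where q: "q \<in> nbrs r V v" "q \<notin> K" using K(1) by blast
  have "\<exists>w\<in>V - K. r w v \<and> (\<exists>a\<in>K. \<exists>b\<in>K. r w a \<and> \<not> r w b)"
  proof (rule ex_mixed_adjacent[OF _ K(3) cK v])
    show "K \<subseteq> V" using K(1) by blast
    show "\<forall>x\<in>K. r v x" using K(1) by blast
    show "q \<in> V" "r v q" using q(1) by simp_all
    have "q \<in> nbrs r V v - K" using q by blast
    then show "\<forall>x\<in>K. \<not> r q x" by (rule bspec[OF K(4)])
  qed (rule q(2))
  then obtain w c where "w \<in> V - K" "r w v" "c \<in> K" "r w c" by blast
  then show False using K(4) sym[of w v] by blast
qed

text \<open>Lying in a triangle spreads along edges: if \<open>x\<close> does, its neighbourhood is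
  connected with at least two vertices, so a neighbour \<open>y\<close> of \<open>x\<close> has a
  neighbour there.\<close>

lemma all_conn_nbrs:
  assumes v: "v \<in> V" "a \<in> V" "b \<in> V" "r v a" "r v b" "r a b" and u: "u \<in> V"
  shows "conn r (nbrs r V u) \<and> 2 \<le> card (nbrs r V u)"
proof -
  define tri where "tri = (\<lambda>u. \<exists>a\<in>nbrs r V u. \<exists>b\<in>nbrs r V u. r a b)"
  have card: "2 \<le> card (nbrs r V u)" if t: "tri u" for u
  proof -
    obtain a b where ab: "a \<in> nbrs r V u" "b \<in> nbrs r V u" "r a b" using t unfolding tri_def by blast
    then have "a \<noteq> b" using irr by auto
    then show ?thesis using card_mono[of "nbrs r V u" "{a, b}"] ab finV by auto
  qed
  have conn: "conn r (nbrs r V u)" if "u \<in> V" "tri u" for u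
    using conn_nbrs[OF that(1)] that(2) unfolding tri_def by blast
  have tv: "tri v" using v by (auto simp: tri_def)
  have "tri u"
  proof (rule ccontr)
    assume nu: "\<not> tri u"
    obtain x y where xy: "x \<in> V" "y \<in> V" "tri x" "\<not> tri y" "r x y"
      using conn_boundary_edge[OF conn_min_imperfect[OF mi] v(1) u tv nu] by blast
    have "nbrs r V x \<noteq> {y}" using card[OF xy(3)] by auto
    then have "\<exists>c\<in>{y}. \<exists>z\<in>nbrs r V x - {y}. r c z"
      using conn[OF xy(1,3), unfolded conn_def, rule_format, of "{y}"] xy by auto
    then obtain z where z: "z \<in> V" "r x z" "r y z" by auto
    then have "tri y" unfolding tri_def using xy sym[of x y] by blast
    then show False using xy by simp
  qed
  then show ?thesis using conn[OF u] card by simp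
qed

text \<open>Pushes a common neighbour one step along the induced path \<open>q' q z p p'\<close>. If
  it failed, \<open>u\<close> and \<open>z\<close> would share a component \<open>K\<close> of the
  neighbours of \<open>p\<close> not adjacent to \<open>p'\<close>; a vertex \<open>w\<close> mixed
  on \<open>K\<close> and adjacent to \<open>p\<close> then leads to a bull.\<close>

lemma P5_common_neighbour:
  assumes V: "q' \<in> V" "q \<in> V" "z \<in> V" "p \<in> V" "p' \<in> V" "u \<in> V"
    and e: "r q' q" "r q z" "r z p" "r p p'"
    and n: "\<not> r q' z" "\<not> r q' p" "\<not> r q' p'" "\<not> r q p" "\<not> r q p'" "\<not> r z p'"
    and u: "r u z" "r u p"
  shows "r u p'"
proof (rule ccontr)
  assume up': "\<not> r u p'"
  define S where "S = {s\<in>V. r p s \<and> \<not> r p' s \<and> s \<noteq> p'}"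
  have fin: "finite S" using finV by (simp add: S_def)
  have "z \<noteq> p'" using e(2) n(5) by auto
  then have zS: "z \<in> S" using V e n sym[OF e(3)] by (auto simp: S_def rsym)
  obtain K where K: "K \<subseteq> S" "z \<in> K" "conn r K" "\<forall>s\<in>S - K. \<forall>k\<in>K. \<not> r s k"
    using ex_component[OF fin zS] by blast
  have KV: "x \<in> V" "r p x" "\<not> r p' x" "r x p" "\<not> r x p'" if "x \<in> K" for x
    using K(1) that by (auto simp: S_def rsym)
  have finK: "finite K" using K(1) fin finite_subset by auto
  have "u \<noteq> p'" using u(1) n(6) sym[of p' z] by auto
  then have "u \<in> S" using V(6) u(2) up' by (auto simp: S_def rsym)
  then have "u \<in> K" using K(2,4) u(1) by blast
  moreover have "u \<noteq> z" using u irr by auto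
  ultimately have cK: "2 \<le> card K"
    using card_mono[OF finK, of "{u, z}"] K(2) by auto
  \<comment> \<open>All of \<open>K\<close> attaches to \<open>q\<close> and \<open>q'\<close> as
    \<open>z\<close> does: a change along an edge \<open>c d\<close> of \<open>K\<close> gives a
    bull on that edge and \<open>p\<close>, with \<open>p'\<close> pendant at \<open>p\<close> and
    \<open>q\<close> or \<open>q'\<close> at the other end.\<close>
  have Kq: "r q x \<and> \<not> r q' x" if x: "x \<in> K" for x
  proof (rule ccontr)
    assume nx: "\<not> (r q x \<and> \<not> r q' x)"
    obtain c d where cd: "c \<in> K" "d \<in> K" "r q c \<and> \<not> r q' c" "\<not> (r q d \<and> \<not> r q' d)" "r c d"
      using conn_boundary_edge[OF K(3,2) x, of "\<lambda>x. r q x \<and> \<not> r q' x"] nx e n by blast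
    have dc: "r d c" "r c q" "\<not> r c q'" using cd(3,5) by (auto simp: rsym)
    have "r q d"
    proof (rule ccontr)
      assume nqd: "\<not> r q d"
      have "r q p'"
        by (rule bull_free_onD[OF bf, of c p d q p'])
           (use V cd dc KV[OF cd(1)] KV[OF cd(2)] nqd e n in \<open>auto simp: rsym\<close>)
      then show False using n by simp
    qed
    then have q'd: "r q' d" using cd by auto
    have "r q' p'"
      by (rule bull_free_onD[OF bf, of d p c q' p'])
         (use V cd dc KV[OF cd(1)] KV[OF cd(2)] q'd e n in \<open>auto simp: rsym\<close>)
    then show False using n by simp
  qed
  have p'K: "p' \<notin> K" using K(1) by (auto simp: S_def)
  have "\<exists>w\<in>V - K. r w p \<and> (\<exists>a\<in>K. \<exists>b\<in>K. r w a \<and> \<not> r w b)"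
    by (rule ex_mixed_adjacent[of K p p']) (use K V KV cK e p'K in auto)
  then obtain w a0 b0 where w: "w \<in> V - K" "r w p" and w0: "a0 \<in> K" "b0 \<in> K" "r w a0" "\<not> r w b0"
    by blast
  obtain a b where ab: "a \<in> K" "b \<in> K" "r w a" "\<not> r w b" "r a b"
    using conn_mixed_edge[OF K(3) w0] by blast
  have sq: "r a q" "\<not> r a q'" "r b q" "\<not> r b q'" using Kq ab(1,2) by (auto simp: rsym)
  have wV: "w \<in> V" using w by simp
  \<comment> \<open>Otherwise \<open>w\<close> belongs to \<open>S\<close> and, by its neighbour in
    \<open>K\<close>, to the component \<open>K\<close>.\<close>
  have wp': "r w p'"
  proof (rule ccontr)
    assume "\<not> r w p'"
    moreover have "w \<noteq> p'" using KV(3)[OF ab(1)] ab(3) by auto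
    ultimately have "w \<in> S" using w by (auto simp: S_def rsym)
    then show False using K(4) w(1) ab(1,3) by blast
  qed
  have wq': "r w q'"
  proof (rule ccontr)
    assume nq': "\<not> r w q'"
    show False
    proof (cases "r w q")
      case True
      have "r p' q'"
        by (rule bull_free_onD[OF bf, of w q a p' q'])
           (use V wV KV[OF ab(1)] True nq' ab sq wp' e n Kq sym[OF e(1)] in \<open>auto simp: rsym\<close>)
      then show False using n(3) sym[of p' q'] by simp
    next
      case False
      have "r w q'"
        by (rule bull_free_onD[OF bf, of a q b w q'])
           (use V wV KV[OF ab(1)] KV[OF ab(2)] False nq' ab sq e n Kq sym[OF e(1)] in \<open>auto simp: rsym\<close>)
      then show False using nq' by simp
    qed
  qed
  \<comment> \<open>Triangle \<open>p w p'\<close> with pendants \<open>b\<close> at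
    \<open>p\<close> and \<open>q'\<close> at \<open>w\<close>.\<close>
  have "r b q'"
    by (rule bull_free_onD[OF bf, of p w p' b q'])
       (use V wV KV[OF ab(2)] wq' wp' w(2) ab n e in \<open>auto simp: rsym\<close>)
  then show False using sq by simp
qed

text \<open>Since the neighbourhood of \<open>g 0\<close> is connected, \<open>g 0\<close> and
  \<open>g 1\<close> have a common neighbour \<open>u\<close>. Any five consecutive vertices of the
  hole induce a path, so \<open>u\<close> is complete to it, which the complement forbids.\<close>

lemma no_long_hole:
  assumes tri: "v \<in> V" "a \<in> V" "b \<in> V" "r v a" "r v b" "r a b"
    and g: "induced_cycle r g n" "6 \<le> n" "range g \<subseteq> V"
  shows False
proof -
  have complete: "r u (g j)" if u: "u \<in> V" "r u (g 0)" "r u (g 1)" for u j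
  proof (rule induced_cycle_induct2[OF g(1), where P = "r u" and k = 0])
    show "r u (g 0)" "r u (g (Suc 0))" using u by simp_all
    fix i assume i: "r u (g i)" "r u (g (Suc i))"
    \<comment> \<open>Rotated by \<open>i - 2\<close>, with \<open>n\<close> added to stay in the
      naturals: \<open>g i\<close> and \<open>g (Suc i)\<close> become \<open>h 2\<close> and
      \<open>h 3\<close>.\<close>
    define h where "h = (\<lambda>j. g (j + (i + n - 2)))"
    have h: "induced_cycle r h n" unfolding h_def by (rule induced_cycle_shift[OF g(1)])
    have hi: "h (k + 2) = g (i + k)" for k
    proof -
      have "k + 2 + (i + n - 2) = (i + k) + n" using g(2) by simp
      then have "h (k + 2) = g ((i + k) + n)" by (simp only: h_def)
      then show ?thesis using induced_cycle_simps(1)[OF g(1), of "(i + k) + n" "i + k"] by simp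
    qed
    have num: "0 + 2 = (2::nat)" "1 + 2 = (3::nat)" "2 + 2 = (4::nat)" by simp_all
    have h23: "r u (h 2)" "r u (h 3)"
      using i unfolding hi[of 0, unfolded num] hi[of 1, unfolded num] by simp_all
    have hV: "h j \<in> V" for j using g(3) by (auto simp: h_def)
    have adj: "r (h i) (h j) \<longleftrightarrow> j = Suc i" if "i < j" "j < 5" for i j
      using induced_cycle_adj(1)[OF h that(1)] that g(2) by auto
    have "r u (h 4)"
      by (rule P5_common_neighbour[of "h 0" "h 1" "h 2" "h 3" "h 4" u])
         (use hV u(1) i h23 in \<open>simp_all add: adj\<close>)
    then show "r u (g (Suc (Suc i)))" using hi[of 2, unfolded num] by simp
  qed
  have g0: "g 0 \<in> V" "g 1 \<in> V" "r (g 0) (g 1)" using g(3) induced_cycle_step[OF g(1), of 0] by auto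
  have c: "conn r (nbrs r V (g 0))" "2 \<le> card (nbrs r V (g 0))"
    using all_conn_nbrs[OF tri g0(1)] by auto
  then have "nbrs r V (g 0) \<noteq> {g 1}" by auto
  then have "\<exists>c\<in>{g 1}. \<exists>z\<in>nbrs r V (g 0) - {g 1}. r c z"
    using c(1)[unfolded conn_def, rule_format, of "{g 1}"] g0 by auto
  then obtain u where u: "u \<in> V" "r (g 0) u" "r (g 1) u" by auto
  have all: "r u (g j)" for j using complete[of u] u sym by blast
  interpret c: sgraph "co r" by (rule sgraph_co)
  show False
  proof (rule c.no_antihole_with_anticomplete_vertex)
    show "prime_on (co r) V" by (rule prime_on_co[OF min_imperfect_prime[OF mi]])
    show "bull_free_on (co r) V" by (rule bull_free_on_co[OF bf])
    show "induced_cycle (co (co r)) g n" using g(1) by (simp add: co_co)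
    show "u \<notin> range g"
    proof
      assume "u \<in> range g"
      then obtain j where "u = g j" by blast
      then show False using all[of j] irr[of u] by simp
    qed
    show "\<not> co r u (g i)" for i using all by (simp add: co_def)
  qed (use g u in auto)
qed

end

lemma induced_path_drop:
  assumes p: "induced_path r p k" and "j \<le> k"
  shows "induced_path r (\<lambda>i. p (i + j)) (k - j)"
  unfolding induced_path_def
proof (intro conjI allI impI)
  have inj: "inj_on p {..k}" using p by (simp add: induced_path_def)
  show "inj_on (\<lambda>i. p (i + j)) {..k - j}"
  proof (rule inj_onI)
    fix x y assume "x \<in> {..k - j}" "y \<in> {..k - j}" "p (x + j) = p (y + j)"
    then show "x = y" using inj_onD[OF inj, of "x + j" "y + j"] assms(2) by simp
  qed
  fix i l assume "i \<le> k - j" "l \<le> k - j"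
  then show "r (p (i + j)) (p (l + j)) \<longleftrightarrow> l = Suc i \<or> i = Suc l"
    using p assms(2) by (auto simp: induced_path_def)
qed

section \<open>Triangles and Hayward's argument\<close>

context min_imperfect_bull_free
begin

text \<open>Without triangles \<open>V - {v}\<close> is 2-colourable but \<open>V\<close> is not, so
  \<open>v\<close> has neighbours of both colours. A shortest path between them in
  \<open>V - {v}\<close> alternates colours, has odd length, and closes with \<open>v\<close> to an
  odd hole.\<close>

lemma ex_triangle:
  shows "\<exists>x\<in>V. \<exists>y\<in>V. \<exists>z\<in>V. r x y \<and> r x z \<and> r y z"
proof (rule ccontr)
  assume no: "\<not> ?thesis"
  obtain w where cr: "critical r V w" using min_imperfect_critical[OF mi] .
  have ncol: "\<not> colourable_on r V w" and clq: "\<forall>K\<subseteq>V. clique r K \<longrightarrow> card K \<le> w"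
    using cr by (auto simp: critical_def)
  have "V \<noteq> {}" using ncol by (auto simp: colourable_on_def)
  then obtain v where v: "v \<in> V" by blast
  have small: "card K \<le> 2" if K: "K \<subseteq> V" "clique r K" for K
  proof (rule ccontr)
    assume "\<not> card K \<le> 2"
    then obtain T where "T \<subseteq> K" "card T = 3" using obtain_subset_with_card_n[of 3 K] by auto
    then obtain x y z where xyz: "x \<in> K" "y \<in> K" "z \<in> K" "x \<noteq> y" "x \<noteq> z" "y \<noteq> z"
      by (auto simp: card_3_iff)
    then have "r x y" "r x z" "r y z" using K(2) by (simp_all add: clique_def)
    then show False using no xyz(1-3) K(1) by blast
  qed
  have two: "\<not> colourable_on r V 2"
  proof
    assume c2: "colourable_on r V 2"
    obtain x where x: "x \<in> V" "r v x" using min_imperfect_nbrs_nonempty[OF mi v] by auto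
    then have "clique r {v, x}" using sym[OF x(2)] by (simp add: clique_def)
    then have "card {v, x} \<le> w" using clq x v by auto
    moreover have "v \<noteq> x" using x irr by auto
    ultimately have "2 \<le> w" by simp
    then show False using colourable_on_mono[OF c2] ncol by blast
  qed
  have "perfect_on r (V - {v})" using mi v by (auto simp: min_imperfect_def)
  moreover have "\<forall>K\<subseteq>V - {v}. clique r K \<longrightarrow> card K \<le> 2" using small by blast
  ultimately have "colourable_on r (V - {v}) 2" by (simp add: perfect_on_def)
  then obtain c :: "'a \<Rightarrow> nat" where c: "\<forall>x\<in>V - {v}. c x < 2"
      "\<forall>x\<in>V - {v}. \<forall>y\<in>V - {v}. r x y \<longrightarrow> c x \<noteq> c y"
    by (auto simp: colourable_on_def)
  have ex: "\<exists>a\<in>nbrs r V v. c a = i" if i: "i < 2" for i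
  proof (rule ccontr)
    assume n: "\<not> ?thesis"
    let ?c = "c(v := i)"
    have "?c x < 2" if "x \<in> V" for x using c(1) that i by auto
    moreover have "?c x \<noteq> ?c y" if xy: "x \<in> V" "y \<in> V" "r x y" for x y
    proof -
      have "x \<noteq> y" using xy irr by auto
      then consider "x = v" "y \<noteq> v" | "x \<noteq> v" "y = v" | "x \<noteq> v" "y \<noteq> v" by blast
      then show ?thesis
      proof cases
        case 1
        then show ?thesis using n xy by auto
      next
        case 2
        then show ?thesis using n xy sym[OF xy(3)] by auto
      next
        case 3
        then show ?thesis using c(2) xy by simp
      qed
    qed
    ultimately show False using two unfolding colourable_on_def by blast
  qed
  define A where "A = (\<lambda>i. {a\<in>nbrs r V v. c a = i})"
  have A: "A 0 \<subseteq> V - {v}" "A 1 \<subseteq> V - {v}" "A 0 \<noteq> {}" "A 1 \<noteq> {}"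
    using ex[of 0] ex[of 1] irr by (auto simp: A_def)
  obtain p k where p': "induced_path r p k" "\<forall>i\<le>k. p i \<in> V - {v}" "p 0 \<in> A 0" "p k \<in> A 1"
    "\<forall>i\<le>k. p i \<in> A 0 \<longrightarrow> i = 0" "\<forall>i\<le>k. p i \<in> A 1 \<longrightarrow> i = k"
    using shortest_path[OF conn_delete_vertex[OF mi v] A] by (elim exE conjE)
  note p = p'(1) p'(2)[rule_format] p'(3,4) p'(5)[rule_format] p'(6)[rule_format]
  have step: "r (p i) (p (Suc i))" if "i < k" for i
    using p(1) that by (auto simp: induced_path_def)
  have par: "i \<le> k \<Longrightarrow> c (p i) = i mod 2" for i
  proof (induction i)
    case 0
    then show ?case using p(3) by (simp add: A_def)
  next
    case (Suc i)
    have "c (p (Suc i)) < 2" "c (p i) \<noteq> c (p (Suc i))" "c (p i) = i mod 2"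
      using c(1) c(2)[rule_format, OF p(2)[of i] p(2)[of "Suc i"]] p(2)[of "Suc i"] step[of i] Suc by auto
    then show ?case by presburger
  qed
  have oddk: "odd k" using par[of k] p(4) by (simp add: A_def odd_iff_mod_2_eq_one)
  have pv: "r v (p i) \<longleftrightarrow> i = 0 \<or> i = k" if i: "i \<le> k" for i
  proof
    assume "r v (p i)"
    moreover have "c (p i) = 0 \<or> c (p i) = 1" using par[OF i] by auto
    ultimately have "p i \<in> A 0 \<or> p i \<in> A 1" using p(2)[OF i] by (auto simp: A_def)
    then show "i = 0 \<or> i = k" using p(5,6) i by blast
  next
    assume "i = 0 \<or> i = k"
    then show "r v (p i)" using p(3,4) by (auto simp: A_def)
  qed
  have "k \<noteq> 1"
  proof
    assume k: "k = 1"
    have "r (p 0) (p 1)" using step[of 0] k by simp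
    moreover have "r v (p 0)" "r v (p 1)" using pv[of 0] pv[of 1] k by simp_all
    moreover have "p 0 \<in> V" "p 1 \<in> V" using p(2)[of 0] p(2)[of 1] k by simp_all
    ultimately show False using no v by blast
  qed
  then have k3: "3 \<le> k" using oddk by presburger
  have nv: "v \<noteq> p i" if "i \<le> k" for i using p(2)[OF that] by auto
  obtain g where g: "induced_cycle r g (k + 2)" "range g \<subseteq> insert v (p ` {..k})"
    using induced_cycle_close_path[OF p(1) _ nv pv] k3 by auto
  have "range g \<subseteq> V" using g(2) v p(2) by fastforce
  then show False using no_odd_hole[OF g(1)] k3 oddk by simp
qed

lemma no_hole:
  assumes g: "induced_cycle r g n" "5 \<le> n" "range g \<subseteq> V"
  shows False
proof (cases "n = 5")
  case True
  then show ?thesis using no_odd_hole[OF g(1)] g by simp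
next
  case False
  obtain x y z where "x \<in> V" "y \<in> V" "z \<in> V" "r x y" "r x z" "r y z" using ex_triangle by blast
  then show ?thesis by (rule no_long_hole[OF _ _ _ _ _ _ g(1) _ g(3)]) (use False g in auto)
qed

text \<open>Hayward's argument for weakly triangulated graphs: a maximal anticonnected set of
  neighbours of \<open>v\<close> having a common neighbour among the nonneighbours of \<open>v\<close> can be extended,
  until this common neighbour dominates \<open>v\<close>.\<close>

lemma no_min_imperfect_bull_free: False
proof -
  interpret c: sgraph "co r" by (rule sgraph_co)
  obtain v where v: "v \<in> V" using ex_triangle by blast
  let ?N = "nbrs r V v"
  let ?M = "nbrs (co r) V v"
  have connM: "conn r ?M" by (rule conn_nonnbrs[OF mi v])
  have connN: "conn (co r) ?N" by (rule conn_co_nbrs[OF mi v])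
  define P where "P = (\<lambda>S. S \<subseteq> ?N \<and> S \<noteq> {} \<and> conn (co r) S \<and> (\<exists>m\<in>?M. \<forall>x\<in>S. r m x))"
  obtain n where n: "n \<in> ?N" using min_imperfect_nbrs_nonempty[OF mi v] by blast
  then obtain m where m: "m \<in> ?M" "r n m" using nbr_has_nonnbr_nbr[OF mi v n] by blast
  have "r m n" by (rule sym[OF m(2)])
  then have "\<exists>m\<in>?M. \<forall>x\<in>{n}. r m x" using m(1) by (intro bexI[of _ m]) simp_all
  then have P0: "P {n}" using n conn_singleton[of "co r" n] by (simp add: P_def)
  have finN: "finite ?N" using finV by simp
  have "\<forall>S. P S \<longrightarrow> card S < Suc (card ?N)"
    using card_mono[OF finN] by (simp add: P_def less_Suc_eq_le)
  then have "\<exists>S. P S \<and> (\<forall>T. P T \<longrightarrow> card T \<le> card S)"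
    by (rule ex_has_greatest_nat[of P, OF P0])
  then obtain S where PS: "P S" and max: "\<forall>T. P T \<longrightarrow> card T \<le> card S"
    by (elim exE conjE)
  have S: "S \<subseteq> ?N" "S \<noteq> {}" "conn (co r) S" using PS by (simp_all add: P_def)
  obtain m where m: "m \<in> ?M" "\<forall>x\<in>S. r m x" using PS by (auto simp: P_def)
  have finS: "finite S" using S(1) finN finite_subset by auto
  have mv: "m \<in> V" "m \<noteq> v" "\<not> r v m" using m(1) by (auto simp: co_def)
  show False
  proof (cases "S = ?N")
    case True
    show False
      by (rule min_imperfect_no_domination[OF mi v mv]) (use m(2) True in auto)
  next
    case False
    have "\<exists>a\<in>S. \<exists>b\<in>?N - S. co r a b"
      using connN[unfolded conn_def, rule_format, OF S(1)] S(2) False by blast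
    then obtain n0 n1 where n0: "n0 \<in> S" and n1: "n1 \<in> ?N" "n1 \<notin> S" and n01: "co r n0 n1" by blast
    have n1V: "n1 \<in> V" "r v n1" using n1 by auto
    have SV: "x \<in> V" "r v x" if "x \<in> S" for x using S(1) that by auto
    have connS1: "conn (co r) (insert n1 S)"
      by (rule conn_insert[OF S(3) n0 n01 c.sym[OF n01]])
    have bigger: False if "m' \<in> ?M" "\<forall>x\<in>insert n1 S. r m' x" for m'
    proof -
      have "insert n1 S \<subseteq> ?N" using n1(1) S(1) by simp
      moreover have "\<exists>m\<in>?M. \<forall>x\<in>insert n1 S. r m x" using that by (intro bexI[of _ m'])
      ultimately have "P (insert n1 S)" unfolding P_def using connS1 by simp
      then have "card (insert n1 S) \<le> card S" using max by blast
      then show False using n1(2) finS by simp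
    qed
    have mn1: "\<not> r m n1"
    proof
      assume "r m n1"
      then show False using bigger[OF m(1)] m(2) by simp
    qed
    define B where "B = {y\<in>?M. r n1 y}"
    have B: "B \<noteq> {}" using nbr_has_nonnbr_nbr[OF mi v n1(1)] by (auto simp: B_def)
    have mB: "{m} \<subseteq> ?M" "B \<subseteq> ?M" "{m} \<noteq> {}" using m(1) by (auto simp: B_def)
    obtain p k where p': "induced_path r p k" "\<forall>i\<le>k. p i \<in> ?M" "p 0 \<in> {m}" "p k \<in> B"
      "\<forall>i\<le>k. p i \<in> {m} \<longrightarrow> i = 0" "\<forall>i\<le>k. p i \<in> B \<longrightarrow> i = k"
      using shortest_path[OF connM mB B] by (elim exE conjE)
    note p = p'(1) p'(2)[rule_format] p'(3,4) p'(5)[rule_format] p'(6)[rule_format]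
    have pM: "p i \<in> V" "p i \<noteq> v" "\<not> r v (p i)" "\<not> r (p i) v" if "i \<le> k" for i
      using p(2)[OF that] rsym[of v "p i"] by (auto simp: co_def)
    have n1p: "r n1 (p i) \<longleftrightarrow> i = k" if "i \<le> k" for i
      using p(4) p(6)[OF that] p(2)[OF that] by (auto simp: B_def)
    let ?m = "p k"
    \<comment> \<open>From the last neighbour \<open>p j\<close> of \<open>x\<close>, the path leads
      to \<open>p k\<close> and \<open>n1\<close>; if \<open>j < k\<close>, adding \<open>x\<close>
      and \<open>v\<close> gives a hole of length \<open>k - j + 4 \<ge> 5\<close>.\<close>
    have near: "r x ?m" if x: "x \<in> S" "\<not> r x n1" for x
    proof -
      define J where "J = {i. i \<le> k \<and> r x (p i)}"
      have finJ: "finite J" by (simp add: J_def)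
      have "r x m" using m(2) x(1) sym by blast
      then have "0 \<in> J" using p(3) by (simp add: J_def)
      then have j: "Max J \<in> J" using Max_in[OF finJ] by blast
      define j where "j = Max J"
      have jk: "j \<le> k" "r x (p j)" using j by (auto simp: J_def j_def)
      have above: "\<not> r x (p i)" if "j < i" "i \<le> k" for i
      proof
        assume "r x (p i)"
        then have "i \<in> J" using that(2) by (simp add: J_def)
        then have "i \<le> j" unfolding j_def by (rule Max_ge[OF finJ])
        then show False using that(1) by simp
      qed
      show ?thesis
      proof (rule ccontr)
        assume "\<not> ?thesis"
        then have "j \<noteq> k" using jk by auto
        then have jk': "j < k" using jk by simp
        define q where "q = (\<lambda>i. p (i + j))"
        have q: "induced_path r q (k - j)"
          unfolding q_def by (rule induced_path_drop[OF p(1) jk(1)])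
        have xq: "r x (q i) \<longleftrightarrow> i = 0" if "i \<le> k - j" for i
          using above[of "i + j"] jk that by (cases i) (auto simp: q_def)
        have n1q: "r n1 (q i) \<longleftrightarrow> i = k - j" if "i \<le> k - j" for i
          using n1p[of "i + j"] that jk by (auto simp: q_def)
        have qM: "q i \<in> V" "q i \<noteq> v" "\<not> r v (q i)" if "i \<le> k - j" for i
          using pM[of "i + j"] that jk by (auto simp: q_def)
        have ne: "x \<noteq> q i" "n1 \<noteq> q i" if "i \<le> k - j" for i
          using qM[OF that] SV[OF x(1)] n1V by auto
        have "x \<noteq> n1" using x n1 by auto
        define Q where "Q = (\<lambda>i. if i = 0 then x else if i \<le> Suc (k - j) then q (i - 1) else n1)"
        have Qp: "induced_path r Q (k - j + 2)" unfolding Q_def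
          by (rule induced_path_extend_both[OF q ne(1) xq ne(2) n1q \<open>x \<noteq> n1\<close> x(2)])
        have Qc: "i = 0 \<and> Q i = x \<or> i = k - j + 2 \<and> Q i = n1 \<or>
            (0 < i \<and> i < k - j + 2 \<and> i - 1 \<le> k - j \<and> Q i = q (i - 1))" if "i \<le> k - j + 2" for i
          using that by (auto simp: Q_def)
        have vQ: "v \<noteq> Q i" "r v (Q i) \<longleftrightarrow> i = 0 \<or> i = k - j + 2" "Q i \<in> V" if "i \<le> k - j + 2" for i
          using Qc[OF that] SV[OF x(1)] n1V qM[of "i - 1"] irr by auto
        obtain g where g: "induced_cycle r g (k - j + 2 + 2)" "range g \<subseteq> insert v (Q ` {..k - j + 2})"
          using induced_cycle_close_path[OF Qp _ vQ(1,2)] by auto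
        have "range g \<subseteq> V" using g(2) v vQ(3) by fastforce
        moreover have "5 \<le> k - j + 2 + 2" using jk' by linarith
        ultimately show False using no_hole[OF g(1)] by blast
      qed
    qed
    show False
    proof (rule bigger[OF p(2)[OF order_refl]], rule ballI, rule ccontr)
      fix x assume "x \<in> insert n1 S" "\<not> r ?m x"
      moreover have "r ?m n1" using n1p[of k] rsym[of ?m n1] by simp
      ultimately have x: "x \<in> S" "\<not> r ?m x" by auto
      define T where "T = {y\<in>S. \<not> r ?m y}"
      have T: "{n1} \<subseteq> insert n1 S" "T \<subseteq> insert n1 S" "{n1} \<noteq> {}" "T \<noteq> {}"
        using x by (auto simp: T_def)
      obtain q l where q': "induced_path (co r) q l" "\<forall>i\<le>l. q i \<in> insert n1 S" "q 0 \<in> {n1}" "q l \<in> T"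
        "\<forall>i\<le>l. q i \<in> {n1} \<longrightarrow> i = 0" "\<forall>i\<le>l. q i \<in> T \<longrightarrow> i = l"
        using c.shortest_path[OF connS1 T] by (elim exE conjE)
      note q = q'(1) q'(2)[rule_format] q'(3,4) q'(5)[rule_format] q'(6)[rule_format]
      have qS: "q i \<in> S" if "i \<le> l" "i \<noteq> 0" for i using q(2,5)[OF that(1)] that(2) by auto
      have q0: "q 0 = n1" using q(3) by simp
      have qV: "q i \<in> V" "r v (q i)" if "i \<le> l" for i
        using q(2)[OF that] SV n1V by auto
      have n': "q l \<in> S" "\<not> r ?m (q l)" using q(4) by (auto simp: T_def)
      \<comment> \<open>\<open>q l\<close> misses \<open>?m\<close>, so by \<open>near\<close> it is
        adjacent to \<open>n1 = q 0\<close>; in the complement they are then at distance at least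
        2.\<close>
      have l0: "l \<noteq> 0" using n'(1) q0 n1(2) by metis
      have "r (q l) n1"
      proof (rule ccontr)
        assume "\<not> r (q l) n1"
        then have "r (q l) ?m" using near n' by blast
        then show False using n' sym by blast
      qed
      have "l \<noteq> 1"
      proof
        assume "l = 1"
        then have "co r (q 0) (q l)" using q(1) by (auto simp: induced_path_def)
        then show False using q0 \<open>r (q l) n1\<close> rsym[of n1] by (auto simp: co_def)
      qed
      then have l2: "2 \<le> l" using l0 by simp
      have mq: "r m (q i) \<longleftrightarrow> i \<noteq> 0" "m \<noteq> q i" if "i \<le> l" for i
        using m(2) qS[OF that] q0 mn1 qV[OF that] mv by (cases "i = 0"; auto)+
      have m'q: "r ?m (q i) \<longleftrightarrow> i \<noteq> l" "?m \<noteq> q i" if "i \<le> l" for i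
      proof -
        show "?m \<noteq> q i" using qV[OF that] pM[of k] by auto
        show "r ?m (q i) \<longleftrightarrow> i \<noteq> l"
        proof
          show "r ?m (q i) \<Longrightarrow> i \<noteq> l" using n' by auto
          assume "i \<noteq> l"
          then have "q i \<notin> T" using q(6)[OF that] by auto
          then show "r ?m (q i)" using q(2)[OF that] \<open>r ?m n1\<close> by (auto simp: T_def)
        qed
      qed
      \<comment> \<open>Triangle \<open>q l\<close>, \<open>n1\<close>, \<open>v\<close> with
        pendants \<open>m\<close> at \<open>q l\<close> and \<open>?m\<close> at
        \<open>n1\<close>.\<close>
      have mm: "r m ?m"
      proof (rule bull_free_onD[OF bf, of "q l" n1 v m ?m])
        show "q l \<in> V" "n1 \<in> V" "v \<in> V" "m \<in> V" "?m \<in> V" using qV[of l] n1V v mv pM[of k] by auto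
        show "r (q l) n1" by fact
        show "r (q l) v" "r n1 v" using qV[of l] n1V rsym[of _ v] by auto
        show "r (q l) m" using mq(1)[of l] l0 rsym[of "q l" m] by simp
        show "r n1 ?m" using n1p[of k] by simp
        show "\<not> r n1 m" using mn1 rsym[of n1 m] by simp
        show "\<not> r v m" by (rule mv)
        show "\<not> r (q l) ?m" using n'(2) rsym[of "q l" ?m] by simp
        show "\<not> r v ?m" using pM[of k] by simp
      qed
      then have nmm: "\<not> co r m ?m" "m \<noteq> ?m" using irr by (auto simp: co_def)
      \<comment> \<open>In the complement \<open>m\<close>, \<open>q 0\<close>, ...,
        \<open>q l\<close>, \<open>?m\<close> is an induced path whose ends alone are joined to
        \<open>v\<close>: an antihole of length \<open>l + 4 \<ge> 6\<close>.\<close>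
      define Q where "Q = (\<lambda>i. if i = 0 then m else if i \<le> Suc l then q (i - 1) else ?m)"
      have mq': "co r m (q i) \<longleftrightarrow> i = 0" and m'q': "co r ?m (q i) \<longleftrightarrow> i = l" if "i \<le> l" for i
        using mq[OF that] m'q[OF that] by (auto simp: co_def)
      have Qp: "induced_path (co r) Q (l + 2)" unfolding Q_def
        by (rule c.induced_path_extend_both[OF q(1) mq(2) mq' m'q(2) m'q' nmm(2,1)])
      have Qc: "i = 0 \<and> Q i = m \<or> i = l + 2 \<and> Q i = ?m \<or>
          (0 < i \<and> i < l + 2 \<and> i - 1 \<le> l \<and> Q i = q (i - 1))" if "i \<le> l + 2" for i
        using that by (auto simp: Q_def)
      have vQ: "v \<noteq> Q i" "co r v (Q i) \<longleftrightarrow> i = 0 \<or> i = l + 2" "Q i \<in> V" if "i \<le> l + 2" for i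
        using Qc[OF that] mv pM[of k] qV[of "i - 1"] irr by (auto simp: co_def)
      obtain g where g: "induced_cycle (co r) g (l + 2 + 2)" "range g \<subseteq> insert v (Q ` {..l + 2})"
        using c.induced_cycle_close_path[OF Qp _ vQ(1,2)] by auto
      have "range g \<subseteq> V" using g(2) v vQ(3) by fastforce
      then show False using no_antihole[OF g(1)] l2 by simp
    qed
  qed
qed

end

section \<open>Weight divisibility\<close>

text \<open>\<open>W\<close> is \<open>V - P\<close>. For finite \<open>V\<close>, beating each
  clique separately amounts to the strict inequality of the maxima.\<close>

definition weight_divisible_on :: "('a \<Rightarrow> 'a \<Rightarrow> bool) \<Rightarrow> ('a \<Rightarrow> nat) \<Rightarrow> 'a set \<Rightarrow> bool" where
  "weight_divisible_on r w V \<longleftrightarrow> (\<exists>P\<subseteq>V. perfect_on r P \<and>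
     (\<forall>K\<subseteq>V - P. clique r K \<longrightarrow> (\<exists>L\<subseteq>V. clique r L \<and> sum w K < sum w L)))"

lemma perfect_on_embedding:
  assumes p: "perfect_on r V" and f: "inj_on f W" "f ` W \<subseteq> V"
    and adj: "\<And>x y. x \<in> W \<Longrightarrow> y \<in> W \<Longrightarrow> r x y \<longleftrightarrow> r (f x) (f y)"
  shows "perfect_on r W"
  unfolding perfect_on_def
proof (intro allI impI)
  fix S k assume S: "S \<subseteq> W" and k: "\<forall>K\<subseteq>S. clique r K \<longrightarrow> card K \<le> k"
  have "\<forall>K\<subseteq>f ` S. clique r K \<longrightarrow> card K \<le> k"
  proof (intro allI impI)
    fix K assume K: "K \<subseteq> f ` S" "clique r K"
    define L where "L = {x\<in>S. f x \<in> K}"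
    have fL: "f ` L = K" using K(1) by (auto simp: L_def)
    have "clique r L" unfolding clique_def
    proof (intro ballI impI)
      fix x y assume xy: "x \<in> L" "y \<in> L" "x \<noteq> y"
      then have W: "x \<in> W" "y \<in> W" using S by (auto simp: L_def)
      then have "f x \<noteq> f y" using f(1) xy(3) by (auto simp: inj_on_def)
      then have "r (f x) (f y)" using K(2) xy(1,2) by (simp add: clique_def L_def)
      then show "r x y" using adj[OF W] by simp
    qed
    moreover have "L \<subseteq> S" by (auto simp: L_def)
    ultimately have "card L \<le> k" using k by blast
    moreover have "inj_on f L" using inj_on_subset[OF f(1), of L] S by (auto simp: L_def)
    ultimately show "card K \<le> k" using fL card_image[of f L] by simp
  qed
  moreover have "f ` S \<subseteq> V" using S f(2) by blast
  ultimately have "colourable_on r (f ` S) k" using p by (simp add: perfect_on_def)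
  then obtain c :: "'a \<Rightarrow> nat" where c: "\<forall>x\<in>f ` S. c x < k" "\<forall>x\<in>f ` S. \<forall>y\<in>f ` S. r x y \<longrightarrow> c x \<noteq> c y"
    by (auto simp: colourable_on_def)
  show "colourable_on r S k" unfolding colourable_on_def
  proof (intro exI[of _ "c \<circ> f"] conjI ballI impI)
    fix x assume "x \<in> S"
    then show "(c \<circ> f) x < k" using c(1) by simp
    fix y assume "y \<in> S" "r x y"
    then have "r (f x) (f y)" using adj[of x y] \<open>x \<in> S\<close> S by auto
    then show "(c \<circ> f) x \<noteq> (c \<circ> f) y" using c(2) \<open>x \<in> S\<close> \<open>y \<in> S\<close> by simp
  qed
qed

lemma perfect_onD:
  "perfect_on r V \<Longrightarrow> S \<subseteq> V \<Longrightarrow> \<forall>K\<subseteq>S. clique r K \<longrightarrow> card K \<le> k \<Longrightarrow> colourable_on r S k"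
  unfolding perfect_on_def by blast

lemma odd_torch_free_on_subset:
  assumes "odd_torch_free_on r V" "S \<subseteq> V"
  shows "odd_torch_free_on r S"
  unfolding odd_torch_free_on_def
proof (intro allI impI)
  fix g n x y
  assume "induced_cycle r g n" "odd n" "5 \<le> n" "range g \<subseteq> S" "x \<in> S" "y \<in> S" "r x y"
    "\<forall>i. \<not> r x (g i)" "\<exists>i. r y (g i)"
  then show "\<exists>i. r y (g i) \<and> r y (g (Suc i))"
    using assms(2) by (intro assms(1)[unfolded odd_torch_free_on_def, rule_format, of g n x y]) auto
qed

lemma ex_max_weight_clique:
  fixes w :: "'a \<Rightarrow> nat"
  assumes "finite X"
  shows "\<exists>K\<subseteq>X. clique r K \<and> (\<forall>L\<subseteq>X. clique r L \<longrightarrow> sum w L \<le> sum w K)"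
proof -
  let ?P = "\<lambda>K. K \<subseteq> X \<and> clique r K"
  have "?P {}" by (simp add: clique_def)
  moreover have "\<forall>L. ?P L \<longrightarrow> sum w L < Suc (sum w X)"
    using assms by (simp add: less_Suc_eq_le sum_mono2)
  ultimately have "\<exists>K. ?P K \<and> (\<forall>L. ?P L \<longrightarrow> sum w L \<le> sum w K)"
    by (rule ex_has_greatest_nat[of ?P])
  then show ?thesis by blast
qed

context sgraph
begin

lemma perfect_on_nonneighbours:
  assumes pr: "prime_on r V" and bf: "bull_free_on r V" and tf: "odd_torch_free_on r V" and v: "v \<in> V"
  shows "perfect_on r (nbrs (co r) V v)"
proof (rule ccontr)
  assume "\<not> ?thesis"
  moreover have "finite (nbrs (co r) V v)" using pr by (simp add: prime_on_def)
  ultimately obtain H where H: "H \<subseteq> nbrs (co r) V v" "min_imperfect r H"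
    using ex_min_imperfect by blast
  have HV: "H \<subseteq> V" "v \<notin> H" "\<And>h. h \<in> H \<Longrightarrow> \<not> r v h" using H(1) by (auto simp: co_def)
  interpret min_imperfect_bull_free r H
  proof unfold_locales
    show "min_imperfect r H" by (rule H(2))
    show "bull_free_on r H" by (rule bull_free_on_subset[OF bf HV(1)])
    fix g :: "nat \<Rightarrow> 'a" and n
    assume gH: "range g \<subseteq> H"
    then have g: "range g \<subseteq> V" "v \<notin> range g" "\<And>i. \<not> r v (g i)" using HV by blast+
    show False if "induced_cycle (co r) g n" "6 \<le> n"
      by (rule no_antihole_with_anticomplete_vertex[OF pr bf that g(1) v g(2,3)])
    show False if "induced_cycle r g n" "5 \<le> n" "odd n"
      by (rule no_odd_hole_with_anticomplete_vertex[OF pr bf tf that(1,3,2) g(1) v g(2,3)])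
  qed
  show False by (rule no_min_imperfect_bull_free)
qed

lemma perfect_on_insert_isolated:
  assumes M: "perfect_on r M" and v: "\<forall>m\<in>M. \<not> r v m"
  shows "perfect_on r (insert v M)"
  unfolding perfect_on_def
proof (intro allI impI)
  fix S k assume S: "S \<subseteq> insert v M" and k: "\<forall>K\<subseteq>S. clique r K \<longrightarrow> card K \<le> k"
  have "S - {v} \<subseteq> M" using S by blast
  moreover have "\<forall>K\<subseteq>S - {v}. clique r K \<longrightarrow> card K \<le> k" using k by blast
  ultimately have "colourable_on r (S - {v}) k" by (rule perfect_onD[OF M])
  then obtain c :: "'a \<Rightarrow> nat" where c: "\<forall>x\<in>S - {v}. c x < k"
      "\<forall>x\<in>S - {v}. \<forall>y\<in>S - {v}. r x y \<longrightarrow> c x \<noteq> c y"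
    by (auto simp: colourable_on_def)
  show "colourable_on r S k" unfolding colourable_on_def
  proof (intro exI[of _ "c(v := 0)"] conjI ballI impI)
    fix x assume x: "x \<in> S"
    show "(c(v := 0)) x < k"
    proof (cases "x = v")
      case True
      then have "card {v} \<le> k" using k[rule_format, of "{v}"] x by (simp add: clique_def)
      then show ?thesis using True by simp
    qed (use c x in auto)
    fix y assume y: "y \<in> S" "r x y"
    have nv: "\<not> r v z" if "z \<in> S" for z using v S irr that by blast
    have "x \<noteq> v" "y \<noteq> v" using nv[OF y(1)] nv[OF x] y(2) sym[OF y(2)] by metis+
    then show "(c(v := 0)) x \<noteq> (c(v := 0)) y" using c(2) x y by simp
  qed
qed

text \<open>A minimal imperfect \<open>H\<close> in the result is prime, so it lies inside
  \<open>Q\<close> or meets \<open>X\<close> at most once. In the latter case it embeds into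
  \<open>P\<close>, with \<open>x\<close> in the role of its vertex in \<open>X\<close>.\<close>

lemma perfect_on_substitute:
  assumes "finite V" and X: "homogeneous r V X"
    and P: "P \<subseteq> V" "P \<inter> X = {x}" "perfect_on r P" and Q: "Q \<subseteq> X" "perfect_on r Q"
  shows "perfect_on r ((P - {x}) \<union> Q)"
proof (rule ccontr)
  assume "\<not> ?thesis"
  moreover have XV: "X \<subseteq> V" using X by (simp add: homogeneous_def)
  have "finite ((P - {x}) \<union> Q)"
    by (rule finite_subset[OF _ assms(1)]) (use P Q XV in blast)
  ultimately obtain H where H: "H \<subseteq> (P - {x}) \<union> Q" "min_imperfect r H"
    using ex_min_imperfect[of "(P - {x}) \<union> Q" r] by blast
  have imp: "\<not> perfect_on r H" using H(2) by (simp add: min_imperfect_def)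
  have HV: "H \<subseteq> V" using H(1) P Q XV by blast
  have hom: "r u b" if "u \<in> V - X" "a \<in> X" "b \<in> X" "r u a" for u a b
    using X that unfolding homogeneous_def by blast
  have "homogeneous r H (H \<inter> X)" using hom HV unfolding homogeneous_def by blast
  then have HX: "2 \<le> card (H \<inter> X) \<Longrightarrow> H \<inter> X = H"
    using min_imperfect_prime[OF H(2)] unfolding prime_on_def by blast
  show False
  proof (cases "2 \<le> card (H \<inter> X)")
    case True
    then have "H \<subseteq> Q" using HX H(1) P(2) by blast
    then show False using imp Q(2) perfect_on_subset by blast
  next
    case False
    show False
    proof (cases "H \<inter> X = {}")
      case True
      then have "H \<subseteq> P" using H(1) Q(1) by blast
      then show False using imp P(3) perfect_on_subset by blast
    next
      case nonempty: False
      have "finite H" using H(2) by (simp add: min_imperfect_def)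
      then have "card (H \<inter> X) = 1" using nonempty False card_gt_0_iff[of "H \<inter> X"] by force
      then obtain h where h: "H \<inter> X = {h}" by (auto simp: card_1_singleton_iff)
      have xX: "x \<in> X" "x \<in> P" using P(2) by auto
      have out: "y \<in> V - X" "y \<in> P" "y \<noteq> x" if "y \<in> H" "y \<noteq> h" for y
        using that h HV H(1) Q(1) xX by blast+
      have hX: "h \<in> X" "h \<in> H" using h by auto
      have eq: "r y h \<longleftrightarrow> r y x" if "y \<in> H" "y \<noteq> h" for y
        using hom[OF out(1)[OF that] hX(1) xX(1)] hom[OF out(1)[OF that] xX(1) hX(1)] by blast
      have "perfect_on r H"
      proof (rule perfect_on_embedding[OF P(3), of "id(h := x)"])
        show "inj_on (id(h := x)) H" using out(3) by (auto simp: inj_on_def)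
        show "id(h := x) ` H \<subseteq> P" using out(2) xX(2) by auto
        fix y z assume yz: "y \<in> H" "z \<in> H"
        show "r y z \<longleftrightarrow> r ((id(h := x)) y) ((id(h := x)) z)"
          using eq[OF yz(1)] eq[OF yz(2)] rsym[of h z] rsym[of x z] irr by auto
      qed
      then show False using imp by simp
    qed
  qed
qed

text \<open>As \<open>K\<close> meets \<open>X\<close>, every vertex of \<open>K - X\<close> has a
  neighbour in \<open>X\<close> and is therefore complete to it.\<close>

lemma homogeneous_exchange_clique:
  assumes X: "homogeneous r V X" and "finite V"
    and K: "K \<subseteq> V" "clique r K" "K \<inter> X \<noteq> {}" and L: "L \<subseteq> X" "clique r L"
  shows "clique r ((K - X) \<union> L)" "(K - X) \<union> L \<subseteq> V"
    "sum (w :: 'a \<Rightarrow> nat) ((K - X) \<union> L) = sum w (K - X) + sum w L"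
proof -
  have XV: "X \<subseteq> V" using X by (simp add: homogeneous_def)
  obtain a where a: "a \<in> K" "a \<in> X" using K(3) by blast
  have 1: "r u b \<and> r b u" if u: "u \<in> K - X" and b: "b \<in> L" for u b
  proof -
    have "r u a" using K(2) u a by (auto simp: clique_def)
    moreover have "u \<in> V - X" "b \<in> X" using u b K(1) L(1) by auto
    ultimately have "r u b" using X a(2) unfolding homogeneous_def by blast
    then show ?thesis using sym by blast
  qed
  show "clique r ((K - X) \<union> L)"
    unfolding clique_def
  proof (intro ballI impI)
    fix x y assume "x \<in> (K - X) \<union> L" "y \<in> (K - X) \<union> L" "x \<noteq> y"
    then consider "x \<in> K - X" "y \<in> L" | "y \<in> K - X" "x \<in> L" | "x \<in> K" "y \<in> K" | "x \<in> L" "y \<in> L"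
      by blast
    then show "r x y"
      using 1[of x y] 1[of y x] K(2) L(2) \<open>x \<noteq> y\<close> by cases (auto simp: clique_def)
  qed
  show "(K - X) \<union> L \<subseteq> V" using K(1) L(1) XV by blast
  have "finite K" by (rule finite_subset[OF K(1) assms(2)])
  moreover have "finite L" by (rule finite_subset[OF subset_trans[OF L(1) XV] assms(2)])
  ultimately show "sum w ((K - X) \<union> L) = sum w (K - X) + sum w L"
    using L(1) by (intro sum.union_disjoint) auto
qed

text \<open>The induction is over all weights because contracting \<open>X\<close> to
  \<open>x\<close> changes the weight of \<open>x\<close>. The contracted graph is the induced
  subgraph on \<open>U\<close>, so it inherits the forbidden subgraphs.\<close>

lemma weight_divisible_on:
  assumes "finite V" "V \<noteq> {}" "bull_free_on r V" "odd_torch_free_on r V" "\<forall>v\<in>V. 0 < w v"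
  shows "weight_divisible_on r w V"
  using assms
proof (induction "card V" arbitrary: V w rule: less_induct)
  case less
  note finV = less.prems(1)
  show ?case
  proof (cases "prime_on r V")
    case True
    obtain v where v: "v \<in> V" using less.prems(2) by blast
    let ?M = "nbrs (co r) V v"
    have "perfect_on r ?M" by (rule perfect_on_nonneighbours[OF True less.prems(3,4) v])
    then have perf: "perfect_on r (insert v ?M)"
      by (rule perfect_on_insert_isolated) (simp add: co_def)
    \<comment> \<open>A clique outside the perfect part consists of neighbours of \<open>v\<close>;
      adding \<open>v\<close> raises its weight.\<close>
    have "\<exists>L\<subseteq>V. clique r L \<and> sum w K < sum w L" if K: "K \<subseteq> V - insert v ?M" "clique r K" for K
    proof (intro exI[of _ "insert v K"] conjI)
      have rv: "r v x" "x \<noteq> v" if "x \<in> K" for x using K(1) that by (auto simp: co_def)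
      then show "clique r (insert v K)" using K(2) rsym unfolding clique_def by blast
      show "insert v K \<subseteq> V" using K(1) v by blast
      have "finite K" using K(1) finV finite_subset by blast
      moreover have "v \<notin> K" using rv by blast
      ultimately show "sum w K < sum w (insert v K)" using less.prems(5) v by simp
    qed
    then show ?thesis unfolding weight_divisible_on_def
      by (intro exI[of _ "insert v ?M"] conjI) (use v perf in auto)
  next
    case False
    then obtain X where X: "homogeneous r V X" "2 \<le> card X" "X \<noteq> V"
      using finV by (auto simp: prime_on_def)
    have XV: "X \<subseteq> V" using X by (simp add: homogeneous_def)
    have finX: "finite X" using XV finV finite_subset by blast
    have "X \<noteq> {}" using X(2) by auto
    then obtain x where x: "x \<in> X" by blast
    define U where "U = insert x (V - X)"
    have UV: "U \<subseteq> V" using x XV by (auto simp: U_def)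
    have UX: "U \<inter> X = {x}" using x by (auto simp: U_def)
    have cX: "card X < card V" using X(3) XV finV by (simp add: psubset_card_mono psubset_eq)
    have cU: "card U < card V"
    proof -
      have "card U = Suc (card (V - X))" using x finV by (simp add: U_def)
      moreover have "card V = card X + card (V - X)"
        using card_Int_Diff[OF finV, of X] XV by (simp add: Int_absorb1)
      ultimately show ?thesis using X(2) by simp
    qed
    obtain M where M: "M \<subseteq> X" "clique r M" "\<forall>L\<subseteq>X. clique r L \<longrightarrow> sum w L \<le> sum w M"
      using ex_max_weight_clique[OF finX, of r w] by blast
    define t where "t = sum w M"
    define w' where "w' = w(x := t)"
    have "sum w {x} \<le> t"
      unfolding t_def using M(3)[rule_format, of "{x}"] x by (simp add: clique_def)
    then have tpos: "0 < t" using less.prems(5) x XV by fastforce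
    have wX: "weight_divisible_on r w X"
      by (rule less.hyps[OF cX finX \<open>X \<noteq> {}\<close> bull_free_on_subset[OF less.prems(3) XV]
            odd_torch_free_on_subset[OF less.prems(4) XV]]) (use less.prems(5) XV in blast)
    have wU: "weight_divisible_on r w' U"
    proof (rule less.hyps[OF cU finite_subset[OF UV finV] _ bull_free_on_subset[OF less.prems(3) UV]
            odd_torch_free_on_subset[OF less.prems(4) UV]])
      show "U \<noteq> {}" by (simp add: U_def)
      show "\<forall>v\<in>U. 0 < w' v" using less.prems(5) UV tpos by (auto simp: w'_def)
    qed
    obtain P where P: "P \<subseteq> U" "perfect_on r P"
        "\<forall>K\<subseteq>U - P. clique r K \<longrightarrow> (\<exists>L\<subseteq>U. clique r L \<and> sum w' K < sum w' L)"
      using wU unfolding weight_divisible_on_def by (elim exE conjE)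
    obtain Q where Q: "Q \<subseteq> X" "perfect_on r Q"
        "\<forall>K\<subseteq>X - Q. clique r K \<longrightarrow> (\<exists>L\<subseteq>X. clique r L \<and> sum w K < sum w L)"
      using wX unfolding weight_divisible_on_def by (elim exE conjE)
    have off: "sum w' L = sum w L" if "x \<notin> L" for L
      unfolding w'_def by (rule sum.cong) (use that in auto)
    \<comment> \<open>Trading \<open>x\<close> for the heaviest clique \<open>M\<close> of
      \<open>X\<close> turns the weight \<open>t\<close> of \<open>x\<close> into an actual weight
      in \<open>V\<close>.\<close>
    have lift: "\<exists>L\<subseteq>V. clique r L \<and> sum w' K \<le> sum w L" if K: "K \<subseteq> U" "clique r K" for K
    proof (cases "x \<in> K")
      case True
      then have KX: "K \<inter> X \<noteq> {}" "K - X = K - {x}" using x K(1) UX by auto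
      have KV: "K \<subseteq> V" using K(1) UV by blast
      note ex = homogeneous_exchange_clique[OF X(1) finV KV K(2) KX(1) M(1,2)]
      have "finite K" using KV finV finite_subset by blast
      then have "sum w' K = t + sum w' (K - {x})"
        using True by (simp add: sum.remove w'_def)
      also have "\<dots> = sum w ((K - X) \<union> M)" using ex(3)[of w] off[of "K - {x}"] KX(2) by (simp add: t_def)
      finally show ?thesis using ex(1,2) by (metis order_refl)
    next
      case False
      then show ?thesis using off[of K] K UV by (intro exI[of _ K]) auto
    qed
    have transfer: "\<exists>L\<subseteq>V. clique r L \<and> sum w K < sum w L"
      if K: "K' \<subseteq> U - P" "clique r K'" "sum w K \<le> sum w' K'" for K K'
    proof -
      obtain L where L: "L \<subseteq> U" "clique r L" "sum w' K' < sum w' L" using P(3) K(1,2) by blast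
      obtain L' where "L' \<subseteq> V" "clique r L'" "sum w' L \<le> sum w L'" using lift[OF L(1,2)] by blast
      then show ?thesis using L(3) K(3) by (intro exI[of _ L']) auto
    qed
    \<comment> \<open>If \<open>x\<close> is in the perfect part, it is replaced by the perfect part
      \<open>Q\<close> of \<open>X\<close>; otherwise all of \<open>X\<close> goes to the other
      part. A clique \<open>K\<close> meeting \<open>X\<close> outside \<open>R\<close> is then
      beaten within \<open>X\<close>, or compared with the clique that has \<open>x\<close> for
      \<open>K \<inter> X\<close>.\<close>
    define R where "R = (if x \<in> P then (P - {x}) \<union> Q else P)"
    have RP: "R - X = P - {x}" using P(1) Q(1) UX x by (auto simp: R_def)
    have "perfect_on r R"
    proof (cases "x \<in> P")
      case True
      then have "P \<subseteq> V" "P \<inter> X = {x}" using P(1) UV UX by auto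
      then show ?thesis
        using perfect_on_substitute[OF finV X(1) _ _ P(2) Q(1,2)] True by (simp add: R_def)
    qed (use P(2) in \<open>simp add: R_def\<close>)
    moreover have "R \<subseteq> V" using P(1) Q(1) UV XV by (auto simp: R_def)
    moreover have "\<exists>L\<subseteq>V. clique r L \<and> sum w K < sum w L" if K: "K \<subseteq> V - R" "clique r K" for K
    proof (cases "K \<inter> X = {}")
      case True
      have "K \<subseteq> U - P" using K(1) True RP x by (auto simp: U_def)
      moreover have "x \<notin> K" using True x by blast
      ultimately show ?thesis using transfer[of K K] K(2) off[of K] by simp
    next
      case False
      have KV: "K \<subseteq> V" using K(1) by blast
      have "finite K" using KV finV finite_subset by blast
      then have split: "sum w K = sum w (K - X) + sum w (K \<inter> X)"
        by (metis add.commute sum.Int_Diff)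
      have clq: "clique r (K \<inter> X)" using clique_subset[OF K(2)] by blast
      show ?thesis
      proof (cases "x \<in> P")
        case True
        then have "K \<inter> X \<subseteq> X - Q" using K(1) by (auto simp: R_def)
        then obtain L where L: "L \<subseteq> X" "clique r L" "sum w (K \<inter> X) < sum w L" using Q(3) clq by blast
        note ex = homogeneous_exchange_clique[OF X(1) finV KV K(2) False L(1,2)]
        show ?thesis using ex(1,2) ex(3)[of w] L(3) split by (intro exI[of _ "(K - X) \<union> L"]) auto
      next
        case nx: False
        have one: "{x} \<subseteq> X" "clique r {x}" using x by (auto simp: clique_def)
        note ex = homogeneous_exchange_clique[OF X(1) finV KV K(2) False one]
        have "(K - X) \<union> {x} \<subseteq> U - P"
          using K(1) nx RP by (auto simp: U_def)
        moreover have "sum w (K \<inter> X) \<le> t" using M(3) clq by (simp add: t_def)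
        then have "sum w K \<le> sum w' ((K - X) \<union> {x})"
          using split ex(3)[of w'] off[of "K - X"] x by (simp add: w'_def)
        ultimately show ?thesis using transfer ex(1) by blast
      qed
    qed
    ultimately show ?thesis unfolding weight_divisible_on_def by blast
  qed
qed

end

section \<open>Perfect divisibility\<close>

lemma sgraph_adj: "simple_graph G \<Longrightarrow> sgraph (adj G)"
  by unfold_locales (auto simp: simple_graph_def)

lemma bull_free_on_adj:
  assumes G: "simple_graph G" and bf: "bull_free G"
  shows "bull_free_on (adj G) (verts G)"
  unfolding bull_free_on_def
proof (intro ballI impI, rule ccontr)
  interpret sgraph "adj G" by (rule sgraph_adj[OF G])
  fix a b c d e
  assume V: "a \<in> verts G" "b \<in> verts G" "c \<in> verts G" "d \<in> verts G" "e \<in> verts G"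
    and 1: "adj G a b" "adj G a c" "adj G b c" "adj G a d" "adj G b e"
    and 0: "\<not> adj G b d" "\<not> adj G c d" "\<not> adj G a e" "\<not> adj G c e" "\<not> adj G d e"
  let ?S = "{a, b, c, d, e}"
  define f where "f = (\<lambda>i. [a, b, c, d, e] ! i)"
  have f: "f 0 = a" "f (Suc 0) = b" "f 2 = c" "f 3 = d" "f 4 = e"
    by (simp_all add: f_def)
  note 1 = 1 1[THEN sym]
  have 0: "\<not> adj G b d" "\<not> adj G c d" "\<not> adj G a e" "\<not> adj G c e" "\<not> adj G d e"
    "\<not> adj G d b" "\<not> adj G d c" "\<not> adj G e a" "\<not> adj G e c" "\<not> adj G e d"
    using 0 sym by metis+
  have ne: "a \<noteq> b" "a \<noteq> c" "a \<noteq> d" "a \<noteq> e" "b \<noteq> c" "b \<noteq> d" "b \<noteq> e" "c \<noteq> d" "c \<noteq> e" "d \<noteq> e"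
    using 1 0 irr by metis+
  have verts: "verts bull = {0, 1, 2, 3, 4}" by (simp add: bull_def Let_def)
  have "bij_betw f (verts bull) ?S"
    unfolding verts bij_betw_def inj_on_def using ne by (simp add: f)
  moreover have "\<forall>x\<in>verts bull. \<forall>y\<in>verts bull. adj bull x y \<longleftrightarrow> adj (induced G ?S) (f x) (f y)"
    unfolding verts by (simp add: f bull_def Let_def induced_def 1 0 irr)
  ultimately have "graph_iso bull (induced G ?S)"
    unfolding graph_iso_def by (intro exI[of _ f]) (simp add: induced_def)
  moreover have "?S \<subseteq> verts G" using V by simp
  ultimately show False
    using bf unfolding bull_free_def free_of_def contains_graph_def by blast
qed

lemma odd_torch_free_on_adj:
  assumes G: "simple_graph G" and tf: "odd_torch_free G"
  shows "odd_torch_free_on (adj G) (verts G)"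
  unfolding odd_torch_free_on_def
proof (intro allI impI, rule ccontr)
  interpret sgraph "adj G" by (rule sgraph_adj[OF G])
  fix g n x y
  assume g: "induced_cycle (adj G) g n" and n: "odd n" "5 \<le> n" and V: "range g \<subseteq> verts G"
      "x \<in> verts G" "y \<in> verts G"
    and xy: "adj G x y" "\<forall>i. \<not> adj G x (g i)" "\<exists>i. adj G y (g i)"
    and no: "\<not> (\<exists>i. adj G y (g i) \<and> adj G y (g (Suc i)))"
  let ?C = "range g"
  define T where "T = induced G (?C \<union> {x, y})"
  have xC: "x \<notin> ?C" using xy(2) induced_cycle_step[OF g] by blast
  have yC: "y \<notin> ?C" using xy(1,2) by blast
  have adjT: "adj T u v \<longleftrightarrow> u \<in> ?C \<union> {x, y} \<and> v \<in> ?C \<union> {x, y} \<and> adj G u v" for u v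
    by (simp add: T_def induced_def)
  have vT: "verts T = ?C \<union> {x, y}" by (simp add: T_def induced_def)
  have simple: "simple_graph T"
    unfolding simple_graph_def vT adjT using induced_cycle_range(2)[OF g] rsym irr by simp
  have card: "card ?C = n" by (rule induced_cycle_range(3)[OF g])
  have "graph_iso (cycle_graph n) (induced T ?C)"
    unfolding graph_iso_def
  proof (intro exI[of _ g] conjI ballI)
    show "bij_betw g (verts (cycle_graph n)) (verts (induced T ?C))"
      using induced_cycle_range(1,4)[OF g] by (simp add: bij_betw_def cycle_graph_def induced_def)
    fix i j assume "i \<in> verts (cycle_graph n)" "j \<in> verts (cycle_graph n)"
    then have ij: "i < n" "j < n" by (simp_all add: cycle_graph_def)
    then have "adj G (g i) (g j) \<longleftrightarrow> Suc i mod n = j \<or> Suc j mod n = i"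
      using induced_cycle_simps(2)[OF g, of i j] by simp
    then show "adj (cycle_graph n) i j \<longleftrightarrow> adj (induced T ?C) (g i) (g j)"
      using ij by (auto simp: cycle_graph_def induced_def adjT)
  qed
  then have hole: "odd_hole T ?C"
    using n by (auto simp: odd_hole_def hole_def card vT)
  have stable: "\<not> adj G (g i) (g j)" if "adj G y (g i)" "adj G y (g j)" for i j
  proof
    assume "adj G (g i) (g j)"
    then have "Suc i mod n = j mod n \<or> Suc j mod n = i mod n" by (simp add: induced_cycle_simps(2)[OF g])
    then have "g (Suc i) = g j \<or> g (Suc j) = g i" by (simp add: induced_cycle_simps(1)[OF g])
    then show False using no that by metis
  qed
  have "odd_torch T" unfolding odd_torch_def
  proof (intro conjI exI)
    show "simple_graph T" by (rule simple)
    show "verts T = ?C \<union> {x, y}" by (rule vT)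
    show "x \<notin> ?C" "y \<notin> ?C" by fact+
    show "x \<noteq> y" using xy(1) irr by auto
    show "odd_hole T ?C" by (rule hole)
    show "adj T x y" using xy(1) by (simp add: adjT)
    show "\<forall>v\<in>?C. \<not> adj T x v" using xy(2) by (simp add: adjT)
    show "{v \<in> ?C. adj T y v} \<noteq> {}" using xy(3) by (auto simp: adjT)
    show "is_stable T {v \<in> ?C. adj T y v}"
      using stable by (auto simp: is_stable_def adjT vT)
  qed
  moreover have "graph_iso T (induced G (?C \<union> {x, y}))"
    unfolding graph_iso_def by (rule exI[of _ id]) (simp add: T_def)
  then have "contains_graph G T"
    unfolding contains_graph_def using V by (intro exI[of _ "?C \<union> {x, y}"]) simp
  ultimately show False using tf unfolding odd_torch_free_def free_of_def by blast
qed

lemma is_clique_induced: "is_clique (induced G S) K \<longleftrightarrow> K \<subseteq> S \<and> clique (adj G) K"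
  unfolding is_clique_def clique_def induced_def by auto

lemma induced_induced: "T \<subseteq> S \<Longrightarrow> induced (induced G S) T = induced G T"
  by (auto simp: induced_def fun_eq_iff)

lemma chromatic_number_eq_clique_number:
  assumes "finite S" "perfect_on (adj G) S"
  shows "chromatic_number (induced G S) = clique_number (induced G S)"
proof -
  let ?A = "{card K |K. is_clique (induced G S) K}"
  have A: "?A = card ` {K. K \<subseteq> S \<and> clique (adj G) K}" by (auto simp: is_clique_induced)
  have fin: "finite ?A" unfolding A using assms(1) by simp
  have "is_clique (induced G S) {}" by (simp add: is_clique_induced clique_def)
  then have "?A \<noteq> {}" by blast
  then have in_A: "Max ?A \<in> ?A" by (rule Max_in[OF fin])
  have "\<forall>K\<subseteq>S. clique (adj G) K \<longrightarrow> card K \<le> Max ?A"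
    using Max_ge[OF fin] by (auto simp: is_clique_induced)
  then have "colourable_on (adj G) S (Max ?A)" by (rule perfect_onD[OF assms(2) subset_refl])
  then have "colourable (induced G S) (Max ?A)"
    unfolding colourable_on_def colourable_def induced_def by auto
  \<comment> \<open>The reverse inequality: a largest clique needs distinct colours.\<close>
  moreover have "Max ?A \<le> k" if col: "colourable (induced G S) k" for k
  proof -
    obtain K where K: "Max ?A = card K" "K \<subseteq> S" "clique (adj G) K"
      using in_A by (auto simp: is_clique_induced)
    obtain c :: "'a \<Rightarrow> nat" where c: "\<forall>x\<in>S. c x < k"
        "\<forall>x\<in>S. \<forall>y\<in>S. adj G x y \<longrightarrow> c x \<noteq> c y"
      using col by (auto simp: colourable_def induced_def)
    have "inj_on c K" by (rule colouring_inj_on_clique[OF c(2) K(3,2)])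
    moreover have "c ` K \<subseteq> {..<k}" using c(1) K(2) by auto
    ultimately have "card K \<le> card {..<k}" by (intro card_inj_on_le[of c]) auto
    then show ?thesis using K(1) by simp
  qed
  ultimately show ?thesis
    unfolding chromatic_number_def clique_number_def by (rule Least_equality)
qed

lemma perfect_induced:
  assumes "finite P" "perfect_on (adj G) P"
  shows "perfect (induced G P)"
  unfolding perfect_def
proof (intro allI impI)
  fix S assume "S \<subseteq> verts (induced G P)"
  then have S: "S \<subseteq> P" by (simp add: induced_def)
  show "chromatic_number (induced (induced G P) S) = clique_number (induced (induced G P) S)"
    unfolding induced_induced[OF S]
    by (rule chromatic_number_eq_clique_number[OF finite_subset[OF S assms(1)] perfect_on_subset[OF assms(2) S]])
qed

lemma weighted_clique_number_less:
  fixes w :: "'a \<Rightarrow> nat"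
  assumes "finite S" "finite W"
    and less: "\<forall>K\<subseteq>W. clique (adj G) K \<longrightarrow> (\<exists>L\<subseteq>S. clique (adj G) L \<and> sum w K < sum w L)"
  shows "weighted_clique_number w (induced G W) < weighted_clique_number w (induced G S)"
proof -
  let ?A = "\<lambda>S. {sum w K |K. is_clique (induced G S) K}"
  have fin: "finite (?A S)" if "finite S" for S
  proof -
    have "?A S = sum w ` {K. K \<subseteq> S \<and> clique (adj G) K}" by (auto simp: is_clique_induced)
    then show ?thesis using that by simp
  qed
  have "is_clique (induced G W) {}" by (simp add: is_clique_induced clique_def)
  then have "?A W \<noteq> {}" by blast
  then have "Max (?A W) \<in> ?A W" by (rule Max_in[OF fin[OF assms(2)]])
  then obtain K where K: "Max (?A W) = sum w K" "K \<subseteq> W" "clique (adj G) K"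
    by (auto simp: is_clique_induced)
  obtain L where L: "L \<subseteq> S" "clique (adj G) L" "sum w K < sum w L" using less K(2,3) by blast
  have "sum w L \<in> ?A S" using L(1,2) by (auto simp: is_clique_induced)
  then have "sum w L \<le> Max (?A S)" by (rule Max_ge[OF fin[OF assms(1)]])
  then show ?thesis using K(1) L(3) by (simp add: weighted_clique_number_def)
qed

lemma perfectly_weight_divisible:
  assumes G: "simple_graph G" and bf: "bull_free G" and tf: "odd_torch_free G"
  shows "perfectly_weight_divisible G"
  unfolding perfectly_weight_divisible_def Let_def
proof (intro allI impI)
  interpret sgraph "adj G" by (rule sgraph_adj[OF G])
  fix w :: "'a \<Rightarrow> nat" and S
  assume w: "\<forall>v\<in>verts G. 0 < w v" and S: "S \<subseteq> verts G \<and> S \<noteq> {}"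
  have finS: "finite S" using G S finite_subset by (auto simp: simple_graph_def)
  have "weight_divisible_on (adj G) w S"
    by (rule weight_divisible_on[OF finS _ bull_free_on_subset[OF bull_free_on_adj[OF G bf]]
          odd_torch_free_on_subset[OF odd_torch_free_on_adj[OF G tf]]]) (use S w in blast)+
  then obtain P where P: "P \<subseteq> S" "perfect_on (adj G) P"
      "\<forall>K\<subseteq>S - P. clique (adj G) K \<longrightarrow> (\<exists>L\<subseteq>S. clique (adj G) L \<and> sum w K < sum w L)"
    unfolding weight_divisible_on_def by (elim exE conjE)
  show "\<exists>P W. P \<union> W = verts (induced G S) \<and> P \<inter> W = {} \<and> perfect (induced (induced G S) P) \<and>
      weighted_clique_number w (induced (induced G S) W) < weighted_clique_number w (induced G S)"
  proof (rule exI[of _ P], rule exI[of _ "S - P"], intro conjI)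
    show "P \<union> (S - P) = verts (induced G S)" using P(1) by (auto simp: induced_def)
    show "perfect (induced (induced G S) P)"
      unfolding induced_induced[OF P(1)]
      by (rule perfect_induced[OF finite_subset[OF P(1) finS] P(2)])
    show "weighted_clique_number w (induced (induced G S) (S - P)) < weighted_clique_number w (induced G S)"
      unfolding induced_induced[OF Diff_subset]
      by (rule weighted_clique_number_less[OF finS _ P(3)]) (simp add: finS)
  qed simp
qed

lemma perfectly_weight_divisible_imp_perfectly_divisible:
  assumes "perfectly_weight_divisible G"
  shows "perfectly_divisible G"
proof -
  \<comment> \<open>Unit weights turn the sum over a clique into its cardinality.\<close>
  have "weighted_clique_number (\<lambda>_. 1) H = clique_number H" for H :: "'a graph"
    by (simp add: weighted_clique_number_def clique_number_def)
  then show ?thesis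
    using assms[unfolded perfectly_weight_divisible_def, rule_format, of "\<lambda>_. 1"]
    by (simp add: perfectly_divisible_def Let_def)
qed

theorem theorem2:
  fixes G :: "'a graph"
  assumes "simple_graph G" and "bull_free G" and "odd_torch_free G"
  shows "perfectly_weight_divisible G \<and> perfectly_divisible G"
  using perfectly_weight_divisible[OF assms] perfectly_weight_divisible_imp_perfectly_divisible by blast

end
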